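(* Let $n\ge 2$, let $a_1<a_2<\cdots<a_n$ be integers, let $\chi(x)=(x-a_1)\cdots(x-a_n)$ and $R=\mathbb{Z}[x]/(\chi(x))$. If $a_n-a_1\geq 4$, then $$|\mathrm{Cl}(R)| = \frac{\varphi(\Delta)}{2^{n-1}} \prod_{l=1}^{n-2} \frac{\varphi(\Delta_l)}{\Delta_l}.$$ If $a_n-a_1<4$, then $|\mathrm{Cl}(R)|=1$.
   Context: Put $K=\mathbb{Q}\otimes_{\mathbb{Z}}R\cong\mathbb{Q}[x]/(\chi(x))$. A fractional $R$-ideal is an $R$-submodule $I\subset K$ that is a free $\mathbb{Z}$-module of rank $n$. Fractional ideals are multiplied in the usual way ($IJ$ consists of finite sums of products $ij$, $i\in I$, $j\in J$). Two fractional $R$-ideals $I,J$ are equivalent if $I=kJ$ for some $k\in K^\times$. The ideal class monoid $\mathrm{ICM}(R)$ is the (commutative) monoid of equivalence classes of fractional $R$-ideals. A fractional $R$-ideal $I$ is invertible if $IJ=R$ for some fractional $R$-ideal $J$. The ideal class group $\mathrm{Cl}(R)$ is the subgroup of $\mathrm{ICM}(R)$ consisting of classes of invertible fractional $R$-ideals. For $S\subset\{1,\dots,n\}$ let $\Delta_S=\prod_{i,j\in S,\ i<j}(a_j-a_i)$. For $1\le k\le n-1$ let $\Delta_k=\gcd_{|S|=k+1}(\Delta_S)$, where $S$ runs over all subsets of $\{1,\dots,n\}$ with $k+1$ elements. Put $\Delta=\Delta_{n-1}=\prod_{1\le i<j\le n}(a_j-a_i)$. $\varphi$ is Euler's totient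 function; an empty product equals $1$. *)

theory Defs
  imports
    "HOL-Algebra.Algebraic_Closure_Type"
    "HOL-Algebra.Ideal_Product"
    "HOL-Algebra.Free_Abelian_Groups"
    "HOL-Algebra.Module"
    "HOL-Number_Theory.Totient"
begin

section \<open>The ring \<open>\<int>[x]/(\<chi>)\<close> and the algebra \<open>\<rat>[x]/(\<chi>)\<close>\<close>

definition R_ring :: "int poly \<Rightarrow> int poly set ring" where
  "R_ring \<chi> = ring_of_type_algebra Quot (PIdl\<^bsub>ring_of_type_algebra\<^esub> \<chi>)"

definition K_ring :: "int poly \<Rightarrow> rat poly set ring" where
  "K_ring \<chi> = ring_of_type_algebra Quot (PIdl\<^bsub>ring_of_type_algebra\<^esub> (map_poly of_int \<chi>))"

definition K_class :: "int poly \<Rightarrow> rat poly \<Rightarrow> rat poly set" where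
  "K_class \<chi> q = PIdl\<^bsub>ring_of_type_algebra\<^esub> (map_poly of_int \<chi>) +>\<^bsub>ring_of_type_algebra\<^esub> q"

text \<open>The canonical map from \<open>\<int>[x]/(\<chi>)\<close> to \<open>\<rat>[x]/(\<chi>)\<close>. All members of a residue class have
  the same image, so \<^const>\<open>the_elem\<close> is applied to a singleton; see \<open>R_to_K_coset\<close> below.\<close>
definition R_to_K :: "int poly \<Rightarrow> int poly set \<Rightarrow> rat poly set" where
  "R_to_K \<chi> A = the_elem ((\<lambda>p. K_class \<chi> (map_poly of_int p)) ` A)"

definition K_alg :: "int poly \<Rightarrow> (int poly set, rat poly set) module" where
  "K_alg \<chi> =
     \<lparr> carrier = carrier (K_ring \<chi>), monoid.mult = monoid.mult (K_ring \<chi>), one = monoid.one (K_ring \<chi>),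
       ring.zero = ring.zero (K_ring \<chi>), ring.add = ring.add (K_ring \<chi>),
       module.smult = (\<lambda>r x. R_to_K \<chi> r \<otimes>\<^bsub>K_ring \<chi>\<^esub> x) \<rparr>"

section \<open>Fractional ideals, ideal class monoid and ideal class group\<close>

text \<open>The rank \<open>n\<close> of a fractional ideal is the degree of \<open>\<chi>\<close>. Freeness over \<open>\<int>\<close> is a statement
  about the additive group of \<open>I\<close> alone.\<close>
definition frac_ideal :: "int poly \<Rightarrow> rat poly set set \<Rightarrow> bool" where
  "frac_ideal \<chi> I \<longleftrightarrow>
     submodule I (R_ring \<chi>) (K_alg \<chi>) \<and>
     add_monoid (K_alg \<chi>\<lparr>carrier := I\<rparr>) \<cong> free_Abelian_group {1..degree \<chi>}"

definition unit_ideal :: "int poly \<Rightarrow> rat poly set set" where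
  "unit_ideal \<chi> = R_to_K \<chi> ` carrier (R_ring \<chi>)"

definition invertible_ideal :: "int poly \<Rightarrow> rat poly set set \<Rightarrow> bool" where
  "invertible_ideal \<chi> I \<longleftrightarrow>
     frac_ideal \<chi> I \<and> (\<exists>J. frac_ideal \<chi> J \<and> I \<cdot>\<^bsub>K_alg \<chi>\<^esub> J = unit_ideal \<chi>)"

definition ideal_equiv :: "int poly \<Rightarrow> (rat poly set set \<times> rat poly set set) set" where
  "ideal_equiv \<chi> =
     {(I, J). frac_ideal \<chi> I \<and> frac_ideal \<chi> J \<and>
        (\<exists>k \<in> Units (K_alg \<chi>). I = k <#\<^bsub>K_alg \<chi>\<^esub> J)}"

definition ideal_class_monoid :: "int poly \<Rightarrow> rat poly set set set monoid" where
  "ideal_class_monoid \<chi> =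
     \<lparr> carrier = {I. frac_ideal \<chi> I} // ideal_equiv \<chi>,
       monoid.mult = (\<lambda>A B. \<Union>I\<in>A. \<Union>J\<in>B. ideal_equiv \<chi> `` {I \<cdot>\<^bsub>K_alg \<chi>\<^esub> J}),
       one = ideal_equiv \<chi> `` {unit_ideal \<chi>} \<rparr>"

definition ideal_class_group :: "int poly \<Rightarrow> rat poly set set set monoid" where
  "ideal_class_group \<chi> =
     ideal_class_monoid \<chi> \<lparr> carrier := {I. invertible_ideal \<chi> I} // ideal_equiv \<chi> \<rparr>"

section \<open>The polynomial \<open>\<chi>\<close> and the numbers \<open>\<Delta>\<^sub>k\<close>\<close>

definition chi :: "nat \<Rightarrow> (nat \<Rightarrow> int) \<Rightarrow> int poly" where
  "chi n a = (\<Prod>i=1..n. [:- a i, 1:])"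

definition Delta_set :: "(nat \<Rightarrow> int) \<Rightarrow> nat set \<Rightarrow> int" where
  "Delta_set a S = (\<Prod>(i, j)\<in>{(i, j). i \<in> S \<and> j \<in> S \<and> i < j}. a j - a i)"

definition Delta :: "nat \<Rightarrow> (nat \<Rightarrow> int) \<Rightarrow> nat \<Rightarrow> nat" where
  "Delta n a k = nat (GCD S\<in>{S. S \<subseteq> {1..n} \<and> card S = k + 1}. Delta_set a S)"

section \<open>Basic facts\<close>

lemma degree_chi: "degree (chi n a) = n"
  unfolding chi_def by (subst degree_prod_eq_sum_degree) auto

lemma Delta_top:
  assumes "n \<ge> 1" and "strict_mono_on {1..n} a"
  shows "int (Delta n a (n - 1)) = Delta_set a {1..n}"
proof -
  have "S = {1..n}" if "S \<subseteq> {1..n}" "card S = n - 1 + 1" for S :: "nat set"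
    using card_subset_eq[of "{1..n}" S] that assms(1) by simp
  then have *: "{S. S \<subseteq> {1..n} \<and> card S = n - 1 + 1} = {{1..n}}"
    using assms(1) by auto
  have "Delta_set a {1..n} \<ge> 0"
    unfolding Delta_set_def
    by (intro prod_nonneg) (auto dest!: strict_mono_onD[OF assms(2), rotated 2])
  then show ?thesis unfolding Delta_def * by simp
qed

lemma cring_R_ring: "cring (R_ring \<chi>)"
  unfolding R_ring_def
  by (intro ideal.quotient_is_cring cring.cgenideal_ideal cring_from_type_algebra)
     (simp add: ring_of_type_algebra_def)

lemma cring_K_ring: "cring (K_ring \<chi>)"
  unfolding K_ring_def
  by (intro ideal.quotient_is_cring cring.cgenideal_ideal cring_from_type_algebra)
     (simp add: ring_of_type_algebra_def)

lemma poly_coset: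
  fixes c :: "'a :: comm_ring_1"
  shows "PIdl\<^bsub>ring_of_type_algebra\<^esub> c +>\<^bsub>ring_of_type_algebra\<^esub> q = {p. c dvd p - q}"
  by (auto simp: ring_of_type_algebra_def cgenideal_def a_r_coset_def r_coset_def dvd_def
      algebra_simps diff_eq_eq)

lemma carrier_R_ring: "carrier (R_ring \<chi>) = range (\<lambda>p. {q. \<chi> dvd q - p})"
  unfolding R_ring_def FactRing_def partial_object.simps A_RCOSETS_def'
  by (auto simp: poly_coset) (auto simp: ring_of_type_algebra_def)

lemma carrier_K_ring: "carrier (K_ring \<chi>) = range (K_class \<chi>)"
  unfolding K_ring_def FactRing_def partial_object.simps A_RCOSETS_def' K_class_def
  by (auto simp: poly_coset) (auto simp: ring_of_type_algebra_def)

lemma K_class_eq_iff: "K_class \<chi> p = K_class \<chi> q \<longleftrightarrow> map_poly of_int \<chi> dvd p - q"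
proof
  assume "K_class \<chi> p = K_class \<chi> q"
  then have "p \<in> {p. map_poly of_int \<chi> dvd p - q}"
    unfolding K_class_def poly_coset by (metis diff_self dvd_0_right mem_Collect_eq)
  then show "map_poly of_int \<chi> dvd p - q" by simp
next
  assume *: "map_poly of_int \<chi> dvd p - q"
  have "map_poly of_int \<chi> dvd r - p \<longleftrightarrow> map_poly of_int \<chi> dvd r - q" for r
    using dvd_add_left_iff[OF *, of "r - p"] by simp
  then show "K_class \<chi> p = K_class \<chi> q" unfolding K_class_def poly_coset by simp
qed

lemma R_to_K_coset: "R_to_K \<chi> {q. \<chi> dvd q - p} = K_class \<chi> (map_poly of_int p)"
proof -
  have "K_class \<chi> (map_poly of_int q) = K_class \<chi> (map_poly of_int p)" if *: "\<chi> dvd q - p" for q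
  proof -
    obtain k where k: "q - p = \<chi> * k" using * unfolding dvd_def by blast
    have "map_poly of_int q - map_poly of_int p = (map_poly of_int (q - p) :: rat poly)"
      by (intro poly_eqI) (simp add: coeff_map_poly)
    also have "\<dots> = map_poly of_int \<chi> * map_poly of_int k"
      unfolding k by (intro poly_eqI) (simp add: coeff_map_poly coeff_mult of_int_sum)
    finally have "map_poly of_int q - map_poly of_int p =
        (map_poly of_int \<chi> * map_poly of_int k :: rat poly)" .
    then show ?thesis by (simp add: K_class_eq_iff)
  qed
  moreover have "p \<in> {q. \<chi> dvd q - p}" by simp
  ultimately have "(\<lambda>p. K_class \<chi> (map_poly of_int p)) ` {q. \<chi> dvd q - p} = {K_class \<chi> (map_poly of_int p)}"
    by blast
  then show ?thesis by (simp add: R_to_K_def)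
qed

lemma K_ring_class_simps:
  "K_class \<chi> p \<otimes>\<^bsub>K_ring \<chi>\<^esub> K_class \<chi> q = K_class \<chi> (p * q)"
  "K_class \<chi> p \<oplus>\<^bsub>K_ring \<chi>\<^esub> K_class \<chi> q = K_class \<chi> (p + q)"
  "\<one>\<^bsub>K_ring \<chi>\<^esub> = K_class \<chi> 1"
proof -
  let ?P = "ring_of_type_algebra :: rat poly ring"
  have "ring_hom_ring ?P (K_ring \<chi>) (K_class \<chi>)"
    unfolding K_ring_def K_class_def
    by (intro ideal.rcos_ring_hom_ring cring.cgenideal_ideal cring_from_type_algebra)
       (simp add: ring_of_type_algebra_def)
  then interpret ring_hom_ring ?P "K_ring \<chi>" "K_class \<chi>" .
  show "K_class \<chi> p \<otimes>\<^bsub>K_ring \<chi>\<^esub> K_class \<chi> q = K_class \<chi> (p * q)"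
    using hom_mult[of p q] by (simp add: ring_of_type_algebra_def)
  show "K_class \<chi> p \<oplus>\<^bsub>K_ring \<chi>\<^esub> K_class \<chi> q = K_class \<chi> (p + q)"
    using hom_add[of p q] by (simp add: ring_of_type_algebra_def)
  show "\<one>\<^bsub>K_ring \<chi>\<^esub> = K_class \<chi> 1"
    using hom_one by (simp add: ring_of_type_algebra_def)
qed

lemma R_ring_class_simps:
  "{r. \<chi> dvd r - p} \<otimes>\<^bsub>R_ring \<chi>\<^esub> {r. \<chi> dvd r - q} = {r. \<chi> dvd r - p * q}"
  "{r. \<chi> dvd r - p} \<oplus>\<^bsub>R_ring \<chi>\<^esub> {r. \<chi> dvd r - q} = {r. \<chi> dvd r - (p + q)}"
  "\<one>\<^bsub>R_ring \<chi>\<^esub> = {r. \<chi> dvd r - 1}"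
proof -
  let ?P = "ring_of_type_algebra :: int poly ring"
  have "ring_hom_ring ?P (R_ring \<chi>) ((+>\<^bsub>?P\<^esub>) (PIdl\<^bsub>?P\<^esub> \<chi>))"
    unfolding R_ring_def
    by (intro ideal.rcos_ring_hom_ring cring.cgenideal_ideal cring_from_type_algebra)
       (simp add: ring_of_type_algebra_def)
  then interpret ring_hom_ring ?P "R_ring \<chi>" "(+>\<^bsub>?P\<^esub>) (PIdl\<^bsub>?P\<^esub> \<chi>)" .
  show "{r. \<chi> dvd r - p} \<otimes>\<^bsub>R_ring \<chi>\<^esub> {r. \<chi> dvd r - q} = {r. \<chi> dvd r - p * q}"
    using hom_mult[of p q] unfolding poly_coset by (simp add: ring_of_type_algebra_def)
  show "{r. \<chi> dvd r - p} \<oplus>\<^bsub>R_ring \<chi>\<^esub> {r. \<chi> dvd r - q} = {r. \<chi> dvd r - (p + q)}"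
    using hom_add[of p q] unfolding poly_coset by (simp add: ring_of_type_algebra_def)
  show "\<one>\<^bsub>R_ring \<chi>\<^esub> = {r. \<chi> dvd r - 1}"
    using hom_one unfolding poly_coset by (simp add: ring_of_type_algebra_def)
qed

lemma R_to_K_hom: "R_to_K \<chi> \<in> ring_hom (R_ring \<chi>) (K_ring \<chi>)"
proof (rule ring_hom_memI)
  have m: "map_poly of_int (p * q) = (map_poly of_int p * map_poly of_int q :: rat poly)" for p q
    by (intro poly_eqI) (simp add: coeff_map_poly coeff_mult of_int_sum)
  have a: "map_poly of_int (p + q) = (map_poly of_int p + map_poly of_int q :: rat poly)" for p q
    by (intro poly_eqI) (simp add: coeff_map_poly)
  show "R_to_K \<chi> x \<in> carrier (K_ring \<chi>)" if "x \<in> carrier (R_ring \<chi>)" for x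
    using that by (auto simp: carrier_R_ring carrier_K_ring R_to_K_coset)
  show "R_to_K \<chi> (x \<otimes>\<^bsub>R_ring \<chi>\<^esub> y) = R_to_K \<chi> x \<otimes>\<^bsub>K_ring \<chi>\<^esub> R_to_K \<chi> y"
    if "x \<in> carrier (R_ring \<chi>)" "y \<in> carrier (R_ring \<chi>)" for x y
    using that by (auto simp: carrier_R_ring R_to_K_coset R_ring_class_simps K_ring_class_simps m)
  show "R_to_K \<chi> (x \<oplus>\<^bsub>R_ring \<chi>\<^esub> y) = R_to_K \<chi> x \<oplus>\<^bsub>K_ring \<chi>\<^esub> R_to_K \<chi> y"
    if "x \<in> carrier (R_ring \<chi>)" "y \<in> carrier (R_ring \<chi>)" for x y
    using that by (auto simp: carrier_R_ring R_to_K_coset R_ring_class_simps K_ring_class_simps a)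
  show "R_to_K \<chi> \<one>\<^bsub>R_ring \<chi>\<^esub> = \<one>\<^bsub>K_ring \<chi>\<^esub>"
    by (simp add: R_to_K_coset R_ring_class_simps K_ring_class_simps)
qed

lemma module_K_alg: "module (R_ring \<chi>) (K_alg \<chi>)"
proof -
  interpret R: cring "R_ring \<chi>" by (rule cring_R_ring)
  interpret K: cring "K_ring \<chi>" by (rule cring_K_ring)
  have h: "R_to_K \<chi> x \<in> carrier (K_ring \<chi>)" if "x \<in> carrier (R_ring \<chi>)" for x
    using ring_hom_closed[OF R_to_K_hom that] .
  note hs = ring_hom_mult[OF R_to_K_hom] ring_hom_add[OF R_to_K_hom] ring_hom_one[OF R_to_K_hom]
  show ?thesis
  proof (rule moduleI)
    show "abelian_group (K_alg \<chi>)"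
    proof (rule abelian_groupI)
      show "\<exists>y \<in> carrier (K_alg \<chi>). y \<oplus>\<^bsub>K_alg \<chi>\<^esub> x = \<zero>\<^bsub>K_alg \<chi>\<^esub>"
        if "x \<in> carrier (K_alg \<chi>)" for x
        using that K.l_neg[of x] K.a_inv_closed[of x] by (auto simp: K_alg_def)
    qed (simp_all add: K_alg_def K.a_ac)
  qed (auto simp: K_alg_def h hs R.cring_axioms K.l_distr K.r_distr K.m_assoc)
qed

end

theory Submission
  imports Defs "HOL-Number_Theory.Residues"
begin

text \<open>
  Evaluation at the nodes \<open>a\<^sub>1 < \<dots> < a\<^sub>n\<close> identifies \<open>K\<close> with \<open>\<rat>\<^sup>n\<close> and \<open>R\<close> with the ring of those integer
  tuples that are values \<open>(g(a\<^sub>1), \<dots>, g(a\<^sub>n))\<close> of some \<open>g \<in> \<int>[x]\<close>; it sits in the maximal order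
  \<open>O = \<int>\<^sup>n\<close>, whose class group is trivial. Put \<open>d\<^sub>j = (a\<^sub>j - a\<^sub>1) \<cdots> (a\<^sub>j - a\<^sub>j\<^sub>-\<^sub>1)\<close>. Newton interpolation
  describes \<open>R\<close> one coordinate at a time: if the first \<open>j - 1\<close> coordinates are values of \<open>g\<close>, the \<open>j\<close>-th one
  has to be congruent to \<open>g(a\<^sub>j)\<close> modulo \<open>d\<^sub>j\<close>, and nothing else is required (\<open>node_values_Suc_iff\<close>). In
  particular \<open>D O \<subseteq> R\<close> for \<open>D = d\<^sub>1 \<cdots> d\<^sub>n = \<Delta>\<close>, so ideals can be studied modulo \<open>D\<close>.

  Up to a factor from \<open>K\<^sup>\<times>\<close>, every invertible ideal has the form \<open>u R + D O\<close>, where all coordinates of \<open>u \<in> O\<close>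
  are prime to \<open>D\<close> (\<open>invertible_equiv_ideal_of\<close>): an invertible ideal is principal modulo \<open>D\<close> because \<open>R/D O\<close>
  is semilocal. Two such ideals, given by \<open>u\<close> and \<open>w\<close>, are equivalent iff \<open>u = e w r\<close> modulo \<open>D\<close> for a tuple \<open>e\<close>
  of signs and some \<open>r \<in> R\<close> prime to \<open>D\<close> (\<open>ideal_of_equiv_iff\<close>), because a factor that carries one into the
  other has to preserve \<open>O\<close>. Hence \<open>Cl(R)\<close> is the quotient of \<open>(O/D O)\<^sup>\<times>\<close> by the signs and by \<open>(R/D O)\<^sup>\<times>\<close>,
  and what remains is to count.

  The group \<open>(O/D O)\<^sup>\<times>\<close> has \<open>\<phi>(D)\<^sup>n\<close> elements. For \<open>(R/D O)\<^sup>\<times>\<close> the coordinates are again chosen one by one.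
  The residue modulo \<open>d\<^sub>j\<close> that interpolation prescribes for the \<open>j\<close>-th coordinate is automatically a unit, since
  \<open>g(a\<^sub>j)\<close> is congruent to the unit \<open>g(a\<^sub>i)\<close> modulo each factor \<open>a\<^sub>j - a\<^sub>i\<close> of \<open>d\<^sub>j\<close>; and a unit modulo \<open>d\<^sub>j\<close> has
  \<open>\<phi>(D) / \<phi>(d\<^sub>j)\<close> lifts to a unit modulo \<open>D\<close>. So the quotient of the two cardinalities is \<open>\<phi>(d\<^sub>1) \<cdots> \<phi>(d\<^sub>n)\<close>
  (\<open>card_unit_node_values\<close>). If \<open>a\<^sub>n - a\<^sub>1 \<ge> 4\<close>, the only sign tuples in \<open>R\<close> are the constant ones
  (\<open>unit_node_values_constant\<close>), so dividing by the signs costs a factor \<open>2\<^sup>n\<^sup>-\<^sup>1\<close>. If \<open>a\<^sub>n - a\<^sub>1 < 4\<close>, every \<open>d\<^sub>j\<close>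
  divides 6, so that all units modulo \<open>d\<^sub>j\<close> are signs, and signs can be chosen successively to move any \<open>u\<close>
  into \<open>R\<close> (\<open>signs_into_node_values\<close>): the class group is trivial.

  Finally, \<open>\<phi>(d\<^sub>1) \<cdots> \<phi>(d\<^sub>n)\<close> is rewritten in terms of the \<open>\<Delta>\<^sub>l\<close> (\<open>prod_totient_newton_step\<close>). Let \<open>r\<^sub>p\<close> be the
  number of residue classes modulo a prime \<open>p\<close> that the nodes meet. Then \<open>p\<close> divides exactly \<open>n - r\<^sub>p\<close> of the \<open>d\<^sub>j\<close>,
  one for every node whose class has occurred before, and it divides \<open>\<Delta>\<^sub>l\<close> iff \<open>r\<^sub>p \<le> l\<close>, by the pigeonhole
  principle, hence exactly \<open>n - r\<^sub>p\<close> of \<open>\<Delta>\<^sub>1, \<dots>, \<Delta>\<^sub>n\<^sub>-\<^sub>1\<close>. So \<open>1 - 1/p\<close> occurs equally often on both sides.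
\<close>

section \<open>Values of integer polynomials at the nodes\<close>

text \<open>Over a domain, dividing out one root leaves the other roots in place, because they are distinct.\<close>
lemma prod_linear_dvd_iff:
  fixes b :: "nat \<Rightarrow> 'a::idom"
  assumes "inj_on b {1..m}"
  shows "(\<Prod>i=1..m. [:- b i, 1:]) dvd p \<longleftrightarrow> (\<forall>i\<in>{1..m}. poly p (b i) = 0)"
  using assms
proof (induction m)
  case (Suc m)
  have inj: "inj_on b {1..m}" using Suc.prems by (auto simp: inj_on_def)
  have ne: "poly (\<Prod>i=1..m. [:- b i, 1:]) (b (Suc m)) \<noteq> 0"
    using inj_onD[OF Suc.prems, of "Suc m"] by (fastforce simp: poly_prod)
  show ?case
  proof
    assume d: "\<forall>i\<in>{1..Suc m}. poly p (b i) = 0"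
    then have "(\<Prod>i=1..m. [:- b i, 1:]) dvd p" using Suc.IH[OF inj] by simp
    then obtain q where q: "p = q * (\<Prod>i=1..m. [:- b i, 1:])" by (metis dvdE mult.commute)
    have "poly p (b (Suc m)) = 0" using d by auto
    then have "poly q (b (Suc m)) = 0" using ne by (simp add: q)
    then have "[:- b (Suc m), 1:] dvd q" by (simp add: poly_eq_0_iff_dvd)
    moreover have "(\<Prod>i=1..Suc m. [:- b i, 1:]) = [:- b (Suc m), 1:] * (\<Prod>i=1..m. [:- b i, 1:])"
      by (rule prod.nat_ivl_Suc') simp
    ultimately show "(\<Prod>i=1..Suc m. [:- b i, 1:]) dvd p"
      unfolding q by (simp only: mult_dvd_mono dvd_refl)
  next
    assume d: "(\<Prod>i=1..Suc m. [:- b i, 1:]) dvd p"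
    have "[:- b i, 1:] dvd p" if "i \<in> {1..Suc m}" for i
      using dvd_trans[OF dvd_prodI[OF _ that] d] by simp
    then show "\<forall>i\<in>{1..Suc m}. poly p (b i) = 0" by (simp add: poly_eq_0_iff_dvd)
  qed
qed simp

text \<open>Newton interpolation: the value at the next node is corrected by a multiple of the polynomial that
  vanishes at all earlier nodes.\<close>
lemma interpolation_exists:
  fixes b v :: "nat \<Rightarrow> 'a::field"
  assumes "inj_on b {1..m}"
  shows "\<exists>q. \<forall>i\<in>{1..m}. poly q (b i) = v i"
  using assms
proof (induction m)
  case (Suc m)
  have inj: "inj_on b {1..m}" using Suc.prems by (auto simp: inj_on_def)
  define N where "N = (\<Prod>i=1..m. [:- b i, 1:])"
  have ne: "poly N (b (Suc m)) \<noteq> 0"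
    using inj_onD[OF Suc.prems, of "Suc m"] by (fastforce simp: poly_prod N_def)
  have N0: "poly N (b i) = 0" if "i \<in> {1..m}" for i
    using that by (auto simp: N_def poly_prod)
  obtain q where q: "\<forall>i\<in>{1..m}. poly q (b i) = v i" using Suc.IH[OF inj] by auto
  define t where "t = (v (Suc m) - poly q (b (Suc m))) / poly N (b (Suc m))"
  have "poly (q + smult t N) (b i) = v i" if "i \<in> {1..Suc m}" for i
    using that q N0 ne by (cases "i = Suc m") (auto simp: t_def)
  then show ?case by blast
qed simp

lemma poly_diff_dvd:
  fixes p :: "'a::comm_ring_1 poly"
  shows "x - y dvd poly p x - poly p y"
proof -
  have "[:- y, 1:] dvd p - [:poly p y:]" by (simp add: poly_eq_0_iff_dvd[symmetric])
  then obtain q where "p - [:poly p y:] = [:- y, 1:] * q" by (elim dvdE)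
  then have "poly (p - [:poly p y:]) x = poly ([:- y, 1:] * q) x" by simp
  then have "poly p x - poly p y = (x - y) * poly q x" by (simp add: algebra_simps)
  then show ?thesis by simp
qed

text \<open>The value at the \<open>j\<close>-th node of the monic polynomial with the earlier nodes as its roots. Once the
  earlier coordinates of a tuple of values are fixed, the \<open>j\<close>-th one is determined exactly modulo this number.\<close>
definition newton_step :: "(nat \<Rightarrow> int) \<Rightarrow> nat \<Rightarrow> int" where
  "newton_step a j = (\<Prod>i=1..<j. a j - a i)"

text \<open>The image of \<open>\<int>[x]\<close> under evaluation at the first \<open>m\<close> nodes; for \<open>m = n\<close> this is the ring \<open>R\<close>. Tuples are
  total functions of which only the coordinates \<open>1, \<dots>, m\<close> matter, so that the ring operations are pointwise.\<close>
definition node_values :: "nat \<Rightarrow> (nat \<Rightarrow> int) \<Rightarrow> (nat \<Rightarrow> int) set" where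
  "node_values m a = {v. \<exists>g. \<forall>i\<in>{1..m}. poly g (a i) = v i}"

lemma node_valuesI: "(\<And>i. i \<in> {1..m} \<Longrightarrow> poly g (a i) = v i) \<Longrightarrow> v \<in> node_values m a"
  unfolding node_values_def by blast

lemma node_values_cong:
  "(\<And>i. i \<in> {1..m} \<Longrightarrow> v i = w i) \<Longrightarrow> v \<in> node_values m a \<longleftrightarrow> w \<in> node_values m a"
  by (simp add: node_values_def)

lemma node_values_poly: "(\<lambda>i. poly g (a i)) \<in> node_values m a"
  by (auto simp: node_values_def)

lemma node_values_const: "(\<lambda>_. c) \<in> node_values m a"
  using node_values_poly[of "[:c:]"] by simp

lemma node_values_add:
  "v \<in> node_values m a \<Longrightarrow> w \<in> node_values m a \<Longrightarrow> (\<lambda>i. v i + w i) \<in> node_values m a"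
  unfolding node_values_def by (auto, metis poly_add)

lemma node_values_diff:
  "v \<in> node_values m a \<Longrightarrow> w \<in> node_values m a \<Longrightarrow> (\<lambda>i. v i - w i) \<in> node_values m a"
  unfolding node_values_def by (auto, metis poly_diff)

lemma node_values_mult:
  "v \<in> node_values m a \<Longrightarrow> w \<in> node_values m a \<Longrightarrow> (\<lambda>i. v i * w i) \<in> node_values m a"
  unfolding node_values_def by (auto, metis poly_mult)

lemma node_values_power:
  "v \<in> node_values m a \<Longrightarrow> (\<lambda>i. v i ^ k) \<in> node_values m a"
  unfolding node_values_def by (auto, metis poly_power)

lemma poly_chi_node: "i \<in> {1..m} \<Longrightarrow> poly (chi m a) (a i) = 0"
  by (auto simp: chi_def poly_prod)

lemma poly_chi_next: "poly (chi m a) (a (Suc m)) = newton_step a (Suc m)"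
  unfolding chi_def newton_step_def poly_prod
  by (rule prod.cong) auto

text \<open>Two polynomials that agree at the first \<open>m\<close> nodes differ by a multiple of \<open>(x - a\<^sub>1) \<cdots> (x - a\<^sub>m)\<close>, and every
  multiple occurs. At the next node these multiples run through the multiples of the Newton step.\<close>
lemma node_values_Suc_iff:
  assumes inj: "inj_on a {1..Suc m}" and g: "\<And>i. i \<in> {1..m} \<Longrightarrow> poly g (a i) = v i"
  shows "v \<in> node_values (Suc m) a \<longleftrightarrow> [v (Suc m) = poly g (a (Suc m))] (mod newton_step a (Suc m))"
proof
  assume "v \<in> node_values (Suc m) a"
  then obtain h where h: "\<And>i. i \<in> {1..Suc m} \<Longrightarrow> poly h (a i) = v i"
    unfolding node_values_def by blast
  have "inj_on a {1..m}" using inj by (auto simp: inj_on_def)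
  then have "chi m a dvd h - g"
    unfolding chi_def by (subst prod_linear_dvd_iff) (use g h in auto)
  then obtain k where "h - g = chi m a * k" by (elim dvdE)
  then have "poly h (a (Suc m)) - poly g (a (Suc m)) = newton_step a (Suc m) * poly k (a (Suc m))"
    by (metis poly_chi_next poly_diff poly_mult)
  then show "[v (Suc m) = poly g (a (Suc m))] (mod newton_step a (Suc m))"
    using h[of "Suc m"] by (simp add: cong_iff_dvd_diff)
next
  assume "[v (Suc m) = poly g (a (Suc m))] (mod newton_step a (Suc m))"
  then obtain t where t: "v (Suc m) - poly g (a (Suc m)) = newton_step a (Suc m) * t"
    by (auto simp: cong_iff_dvd_diff elim: dvdE)
  have "poly (g + smult t (chi m a)) (a i) = v i" if "i \<in> {1..Suc m}" for i
    using that g t poly_chi_node[of i m a] poly_chi_next[of m a]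
    by (cases "i = Suc m") (auto simp: mult.commute)
  then show "v \<in> node_values (Suc m) a" by (rule node_valuesI)
qed

text \<open>The product of the Newton steps lies in the conductor of \<open>R\<close> in \<open>\<int>\<^sup>n\<close>: multiplying an interpolating
  polynomial by the next Newton step satisfies the congruence required at the next node.\<close>
lemma node_values_conductor:
  assumes "inj_on a {1..m}"
  shows "(\<lambda>i. (\<Prod>j=1..m. newton_step a j) * w i) \<in> node_values m a"
  using assms
proof (induction m)
  case (Suc m)
  define D where "D = (\<Prod>j=1..m. newton_step a j)"
  let ?d = "newton_step a (Suc m)"
  have "inj_on a {1..m}" using Suc.prems by (auto simp: inj_on_def)
  then have "(\<lambda>i. D * w i) \<in> node_values m a" using Suc.IH by (simp add: D_def)
  then obtain g where g: "\<And>i. i \<in> {1..m} \<Longrightarrow> poly g (a i) = D * w i"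
    unfolding node_values_def by blast
  have "(\<lambda>i. D * ?d * w i) \<in> node_values (Suc m) a"
    by (subst node_values_Suc_iff[OF Suc.prems, where g = "smult ?d g"])
       (auto simp: g cong_iff_dvd_diff mult_ac intro: dvd_diff)
  then show ?case by (simp add: D_def prod.nat_ivl_Suc' mult.commute)
qed (auto simp: node_values_def)

text \<open>The factors \<open>a\<^sub>m\<^sub>+\<^sub>1 - a\<^sub>i\<close> of the Newton step divide \<open>g(a\<^sub>m\<^sub>+\<^sub>1) - g(a\<^sub>i)\<close>, so coprimality is inherited
  from the earlier nodes. For this reason prescribing units at the earlier nodes never obstructs the next one.\<close>
lemma coprime_newton_step:
  assumes "\<And>i. i \<in> {1..m} \<Longrightarrow> coprime (poly g (a i)) M" and "newton_step a (Suc m) dvd M"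
  shows "coprime (poly g (a (Suc m))) (newton_step a (Suc m))"
  unfolding newton_step_def
proof (rule prod_coprime_right)
  fix i assume i: "i \<in> {1..<Suc m}"
  have "[poly g (a (Suc m)) = poly g (a i)] (mod a (Suc m) - a i)"
    by (simp add: cong_iff_dvd_diff poly_diff_dvd)
  moreover have "a (Suc m) - a i dvd M"
    using assms(2) dvd_prodI[of "{1..<Suc m}" i "\<lambda>i. a (Suc m) - a i"] i
    unfolding newton_step_def by (meson dvd_trans finite_atLeastLessThan)
  then have "coprime (poly g (a i)) (a (Suc m) - a i)"
    using coprime_divisors[OF dvd_refl _ assms(1)[of i]] i by auto
  ultimately show "coprime (poly g (a (Suc m))) (a (Suc m) - a i)"
    using cong_imp_coprime cong_sym by blast
qed

section \<open>Units modulo an integer and their lifts\<close>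

text \<open>Representatives start at 0 and not at 1, so that \<open>x mod M\<close> is always the representative of \<open>x\<close>; for
  \<open>M = 1\<close> the only one is 0.\<close>
definition unit_residues :: "int \<Rightarrow> int set" where
  "unit_residues M = {x \<in> {0..<M}. coprime x M}"

lemma finite_unit_residues [simp]: "finite (unit_residues M)"
  unfolding unit_residues_def by (rule finite_subset[of _ "{0..<M}"]) auto

lemma mod_in_unit_residues: "M > 0 \<Longrightarrow> coprime x M \<Longrightarrow> x mod M \<in> unit_residues M"
  by (simp add: unit_residues_def coprime_commute)

lemma card_unit_residues:
  assumes "M > 0"
  shows "card (unit_residues M) = totient (nat M)"
proof -
  have "bij_betw (\<lambda>k. int k mod M) (totatives (nat M)) (unit_residues M)"
  proof (rule bij_betw_byWitness[where f' = "\<lambda>x. if x = 0 then nat M else nat x"])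
    show "\<forall>k\<in>totatives (nat M). (if int k mod M = 0 then nat M else nat (int k mod M)) = k"
    proof
      fix k assume k: "k \<in> totatives (nat M)"
      then have "0 < k" "k \<le> nat M" by (auto simp: in_totatives_iff)
      then show "(if int k mod M = 0 then nat M else nat (int k mod M)) = k"
        using assms by (cases "k = nat M") auto
    qed
    show "\<forall>x\<in>unit_residues M. int (if x = 0 then nat M else nat x) mod M = x"
      using assms by (auto simp: unit_residues_def)
    show "(\<lambda>k. int k mod M) ` totatives (nat M) \<subseteq> unit_residues M"
    proof (intro image_subsetI mod_in_unit_residues assms)
      fix k assume "k \<in> totatives (nat M)"
      then have "coprime (int k) (int (nat M))" by (simp only: in_totatives_iff coprime_int_iff)
      then show "coprime (int k) M" using assms by simp
    qed
    show "(\<lambda>x. if x = 0 then nat M else nat x) ` unit_residues M \<subseteq> totatives (nat M)"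
    proof (intro image_subsetI)
      fix x assume x: "x \<in> unit_residues M"
      show "(if x = 0 then nat M else nat x) \<in> totatives (nat M)"
      proof (cases "x = 0")
        case True
        then have "M = 1" using x assms by (simp add: unit_residues_def)
        then show ?thesis using True by (simp add: in_totatives_iff)
      next
        case False
        have "coprime (int (nat x)) (int (nat M))" using x assms by (simp add: unit_residues_def)
        then show ?thesis
          unfolding coprime_int_iff using x False assms by (auto simp: unit_residues_def in_totatives_iff)
      qed
    qed
  qed
  then show ?thesis using bij_betw_same_card unfolding totient_def by metis
qed

lemma common_prime_divisor:
  fixes x M :: int
  assumes "M \<noteq> 0" and "\<not> coprime x M"
  shows "\<exists>p. prime p \<and> p dvd x \<and> p dvd M"
  using prime_divisor_exists[of "gcd x M"] assms by (auto simp: is_unit_gcd)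

lemma euler_theorem_int:
  fixes x m :: int
  assumes "m > 0" "coprime x m"
  shows "[x ^ totient (nat m) = 1] (mod m)"
proof (cases "m = 1")
  case False
  then have "residues m" using assms(1) by (simp add: residues_def)
  then show ?thesis using residues.euler_theorem assms(2) by blast
qed simp

text \<open>A unit modulo \<open>d\<close> is made prime to \<open>M\<close> by adding \<open>d\<close> times the product of those primes of \<open>M\<close> that do not
  divide it: each prime of \<open>M\<close> then divides exactly one of the two summands.\<close>
lemma coprime_lift_exists:
  fixes x d M :: int
  assumes "M \<noteq> 0" and "coprime x d"
  shows "\<exists>y. coprime y M \<and> [y = x] (mod d)"
proof -
  define P where "P = {p \<in> prime_factors M. \<not> p dvd x}"
  define t where "t = \<Prod>P"
  have fin: "finite P" by (simp add: P_def)
  have "coprime (x + d * t) M"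
  proof (rule ccontr)
    assume "\<not> coprime (x + d * t) M"
    then obtain p where p: "prime p" "p dvd x + d * t" "p dvd M"
      using assms(1) using common_prime_divisor by blast
    show False
    proof (cases "p dvd x")
      case True
      then have "p dvd d * t" using p(2) by (simp add: dvd_add_right_iff)
      moreover have "\<not> p dvd d" using coprime_common_divisor[OF assms(2) True] p(1) not_prime_unit by blast
      ultimately have "p dvd t" using p(1) by (simp add: prime_dvd_mult_iff)
      then obtain q where "q \<in> P" "p dvd q" unfolding t_def
        using prime_dvd_prod_iff[OF fin p(1), of "\<lambda>x. x"] by auto
      then show False using True p(1) primes_dvd_imp_eq[of p q] by (auto simp: P_def)
    next
      case False
      then have "p \<in> P" using p assms(1) by (auto simp: P_def in_prime_factors_iff)
      then have "p dvd t" unfolding t_def using dvd_prodI[OF fin, of p "\<lambda>x. x"] by simp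
      then show False using p(2) False by (metis dvd_add_left_iff dvd_mult)
    qed
  qed
  moreover have "[x + d * t = x] (mod d)" by (simp add: cong_iff_dvd_diff)
  ultimately show ?thesis by blast
qed

lemma card_eq_mult_fibres:
  assumes "finite A" and "\<And>y. y \<in> f ` A \<Longrightarrow> card {x \<in> A. f x = y} = k"
  shows "card A = k * card (f ` A)"
proof -
  have "card A = (\<Sum>y\<in>f ` A. card {x \<in> A. f x = y})"
    using sum.image_gen[OF assms(1), of "\<lambda>_. 1::nat" f] by simp
  then show ?thesis using assms(2) by (simp add: mult.commute)
qed

text \<open>Multiplication by a unit permutes the fibres of the reduction from units modulo \<open>M\<close> to units modulo \<open>d\<close>.
  Reduction is surjective, so all fibres have \<open>\<phi>(M) / \<phi>(d)\<close> elements.\<close>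
lemma card_unit_lifts:
  fixes M d b :: int
  assumes M: "M > 0" and d: "d > 0" "d dvd M" and b: "coprime b d"
  shows "card {x \<in> unit_residues M. [x = b] (mod d)} * totient (nat d) = totient (nat M)"
proof -
  have fib: "card {x \<in> unit_residues M. [x = c] (mod d)} = card {x \<in> unit_residues M. [x = 1] (mod d)}"
    if c: "coprime c d" for c
  proof -
    obtain y where y: "coprime y M" "[y = c] (mod d)"
      using coprime_lift_exists[of M c d] c M by auto
    obtain z where z: "[y * z = 1] (mod M)" using y(1) cong_solve_coprime_int by auto
    have zM: "coprime z M" using z by (metis coprime_iff_invertible_int mult.commute)
    have zd: "[y * z = 1] (mod d)" using z d(2) cong_dvd_modulus by blast
    have "bij_betw (\<lambda>x. (y * x) mod M) {x \<in> unit_residues M. [x = 1] (mod d)} {x \<in> unit_residues M. [x = c] (mod d)}"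
    proof (rule bij_betw_byWitness[where f' = "\<lambda>x. (z * x) mod M"])
      have *: "(z * (y * x mod M)) mod M = x" "(y * (z * x mod M)) mod M = x"
        if "x \<in> unit_residues M" for x
      proof -
        have "[y * z * x = 1 * x] (mod M)" using z by (rule cong_scalar_right)
        then show "(z * (y * x mod M)) mod M = x" "(y * (z * x mod M)) mod M = x"
          using that by (auto simp: unit_residues_def cong_def mod_simps mult_ac)
      qed
      then show "\<forall>x\<in>{x \<in> unit_residues M. [x = 1] (mod d)}. (z * (y * x mod M)) mod M = x"
        "\<forall>x\<in>{x \<in> unit_residues M. [x = c] (mod d)}. (y * (z * x mod M)) mod M = x" by auto
      have **: "[x mod M = x] (mod d)" for x
        using d(2) by (simp add: cong_def mod_mod_cancel)
      have "[y * x mod M = c] (mod d)" if "[x = 1] (mod d)" for x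
        using cong_trans[OF ** cong_mult[OF y(2) that]] by simp
      then show "(\<lambda>x. (y * x) mod M) ` {x \<in> unit_residues M. [x = 1] (mod d)} \<subseteq> {x \<in> unit_residues M. [x = c] (mod d)}"
        using y(1) M by (auto intro!: mod_in_unit_residues simp: unit_residues_def)
      have "[z * x mod M = 1] (mod d)" if "[x = c] (mod d)" for x
      proof -
        have "[z * x = z * y] (mod d)"
          using cong_trans[OF that cong_sym[OF y(2)]] by (rule cong_scalar_left)
        then show ?thesis
          using ** zd by (metis cong_trans mult.commute)
      qed
      then show "(\<lambda>x. (z * x) mod M) ` {x \<in> unit_residues M. [x = c] (mod d)} \<subseteq> {x \<in> unit_residues M. [x = 1] (mod d)}"
        using zM M by (auto intro!: mod_in_unit_residues simp: unit_residues_def)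
    qed
    from bij_betw_same_card[OF this] show ?thesis by simp
  qed
  have img: "(\<lambda>x. x mod d) ` unit_residues M = unit_residues d"
  proof (intro equalityI subsetI)
    fix x assume "x \<in> (\<lambda>x. x mod d) ` unit_residues M"
    then obtain y where y: "x = y mod d" "coprime y M" by (auto simp: unit_residues_def)
    then have "coprime y d" using d(2) coprime_divisors dvd_refl by blast
    then show "x \<in> unit_residues d" unfolding y(1) by (rule mod_in_unit_residues[OF d(1)])
  next
    fix x assume x: "x \<in> unit_residues d"
    then obtain y where y: "coprime y M" "[y = x] (mod d)"
      using coprime_lift_exists[of M x d] M by (auto simp: unit_residues_def)
    have "(y mod M) mod d = x" using y(2) x d(2)
      by (simp add: cong_def mod_mod_cancel unit_residues_def)
    then show "x \<in> (\<lambda>x. x mod d) ` unit_residues M"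
      using mod_in_unit_residues[OF M y(1)] by (metis imageI)
  qed
  have "card (unit_residues M) = card {x \<in> unit_residues M. [x = 1] (mod d)} * card ((\<lambda>x. x mod d) ` unit_residues M)"
  proof (rule card_eq_mult_fibres)
    fix c assume "c \<in> (\<lambda>x. x mod d) ` unit_residues M"
    then have c: "c \<in> unit_residues d" using img by simp
    then have "{x \<in> unit_residues M. x mod d = c} = {x \<in> unit_residues M. [x = c] (mod d)}"
      by (auto simp: unit_residues_def cong_def)
    moreover have "coprime c d" using c by (simp add: unit_residues_def)
    ultimately show "card {x \<in> unit_residues M. x mod d = c} = card {x \<in> unit_residues M. [x = 1] (mod d)}"
      using fib[of c] by simp
  qed simp
  then show ?thesis using fib[OF b] M d(1) by (simp add: img card_unit_residues)
qed

section \<open>Counting unit tuples and sign tuples\<close>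

text \<open>The tuples counted here represent the units of \<open>R\<close> modulo the conductor. Forgetting the last coordinate is a
  surjection onto the corresponding set for one node fewer. Its fibres are the sets of lifts of one unit modulo the
  last Newton step, and therefore all have the same size.\<close>
lemma card_unit_node_values:
  assumes "inj_on a {1..m}" and "M > 0"
    and "\<And>j. j \<in> {1..m} \<Longrightarrow> newton_step a j > 0 \<and> newton_step a j dvd M"
  shows "card (({1..m} \<rightarrow>\<^sub>E unit_residues M) \<inter> node_values m a) *
           (\<Prod>j=1..m. totient (nat (newton_step a j))) = totient (nat M) ^ m"
  using assms
proof (induction m)
  case 0
  have "node_values 0 a = UNIV" by (auto simp: node_values_def)
  then show ?case by simp
next
  case (Suc m)
  let ?H = "\<lambda>m. ({1..m} \<rightarrow>\<^sub>E unit_residues M) \<inter> node_values m a"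
  let ?d = "newton_step a (Suc m)"
  define k where "k = totient (nat M) div totient (nat ?d)"
  have inj: "inj_on a {1..m}" using Suc.prems(1) by (auto simp: inj_on_def)
  have d: "?d > 0" "?d dvd M" using Suc.prems(3)[of "Suc m"] by auto
  have IH: "card (?H m) * (\<Prod>j=1..m. totient (nat (newton_step a j))) = totient (nat M) ^ m"
    by (rule Suc.IH[OF inj Suc.prems(2)]) (use Suc.prems(3) in auto)
  have tot: "totient (nat M) > 0" "totient (nat ?d) > 0" using Suc.prems(2) d by simp_all
  have fibre: "card {v \<in> ?H (Suc m). restrict v {1..m} = w} * totient (nat ?d) = totient (nat M)"
    if w: "w \<in> ?H m" for w
  proof -
    from w obtain g where g: "\<And>i. i \<in> {1..m} \<Longrightarrow> poly g (a i) = w i"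
      unfolding node_values_def by blast
    let ?b = "poly g (a (Suc m))"
    have "coprime ?b ?d"
    proof (rule coprime_newton_step[OF _ d(2)])
      fix i assume "i \<in> {1..m}"
      moreover from this have "w i \<in> unit_residues M" using w by (auto simp: PiE_def)
      ultimately show "coprime (poly g (a i)) M" using g[of i] by (auto simp: unit_residues_def)
    qed
    have key: "v \<in> node_values (Suc m) a \<longleftrightarrow> [v (Suc m) = ?b] (mod ?d)"
      if "\<And>i. i \<in> {1..m} \<Longrightarrow> v i = w i" for v
      by (rule node_values_Suc_iff[OF Suc.prems(1)]) (use g that in auto)
    have "bij_betw (\<lambda>x. w(Suc m := x)) {x \<in> unit_residues M. [x = ?b] (mod ?d)}
        {v \<in> ?H (Suc m). restrict v {1..m} = w}"
    proof (rule bij_betw_byWitness[where f' = "\<lambda>v. v (Suc m)"])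
      have wext: "w \<in> extensional {1..m}" using w by (auto simp: PiE_def)
      show "\<forall>x\<in>{x \<in> unit_residues M. [x = ?b] (mod ?d)}. (w(Suc m := x)) (Suc m) = x" by simp
      show "\<forall>v\<in>{v \<in> ?H (Suc m). restrict v {1..m} = w}. w(Suc m := v (Suc m)) = v"
      proof (intro ballI ext)
        fix v i assume v: "v \<in> {v \<in> ?H (Suc m). restrict v {1..m} = w}"
        then have "v i = undefined" if "i \<notin> {1..Suc m}" using that by (auto simp: PiE_def extensional_def)
        then show "(w(Suc m := v (Suc m))) i = v i"
          using v by (cases "i = Suc m"; cases "i \<in> {1..m}") auto
      qed
      show "(\<lambda>x. w(Suc m := x)) ` {x \<in> unit_residues M. [x = ?b] (mod ?d)} \<subseteq>
          {v \<in> ?H (Suc m). restrict v {1..m} = w}"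
      proof (intro image_subsetI)
        fix x assume x: "x \<in> {x \<in> unit_residues M. [x = ?b] (mod ?d)}"
        have 1: "w(Suc m := x) \<in> node_values (Suc m) a" using x by (subst key) auto
        have 2: "w(Suc m := x) \<in> {1..Suc m} \<rightarrow>\<^sub>E unit_residues M"
          using w x by (auto simp: PiE_def extensional_def Pi_def le_Suc_eq)
        have 3: "restrict (w(Suc m := x)) {1..m} = w"
          using wext by (auto simp: fun_eq_iff extensional_def restrict_def)
        show "w(Suc m := x) \<in> {v \<in> ?H (Suc m). restrict v {1..m} = w}" using 1 2 3 by blast
      qed
      show "(\<lambda>v. v (Suc m)) ` {v \<in> ?H (Suc m). restrict v {1..m} = w} \<subseteq>
          {x \<in> unit_residues M. [x = ?b] (mod ?d)}"
      proof (intro image_subsetI)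
        fix v assume v: "v \<in> {v \<in> ?H (Suc m). restrict v {1..m} = w}"
        then have "v i = w i" if "i \<in> {1..m}" for i using that by auto
        then have "[v (Suc m) = ?b] (mod ?d)" using key[of v] v by auto
        then show "v (Suc m) \<in> {x \<in> unit_residues M. [x = ?b] (mod ?d)}"
          using v by (auto simp: PiE_def Pi_def)
      qed
    qed
    from bij_betw_same_card[OF this] show ?thesis using card_unit_lifts[OF Suc.prems(2) d \<open>coprime ?b ?d\<close>] by simp
  qed
  have img: "(\<lambda>v. restrict v {1..m}) ` ?H (Suc m) = ?H m"
  proof (intro equalityI subsetI)
    fix w assume "w \<in> (\<lambda>v. restrict v {1..m}) ` ?H (Suc m)"
    then obtain v where v: "v \<in> ?H (Suc m)" "w = restrict v {1..m}" by blast
    then obtain g where "\<And>i. i \<in> {1..Suc m} \<Longrightarrow> poly g (a i) = v i"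
      unfolding node_values_def by blast
    then have "w \<in> node_values m a" by (intro node_valuesI[of m g]) (auto simp: v(2))
    then show "w \<in> ?H m" using v by (auto simp: PiE_def Pi_def)
  next
    fix w assume "w \<in> ?H m"
    then have "card {v \<in> ?H (Suc m). restrict v {1..m} = w} \<noteq> 0"
      using fibre[of w] tot by (intro notI) simp
    then have "{v \<in> ?H (Suc m). restrict v {1..m} = w} \<noteq> {}" by (metis card.empty)
    then show "w \<in> (\<lambda>v. restrict v {1..m}) ` ?H (Suc m)" by blast
  qed
  have "card (?H (Suc m)) = k * card ((\<lambda>v. restrict v {1..m}) ` ?H (Suc m))"
  proof (rule card_eq_mult_fibres)
    show "finite (?H (Suc m))" by (intro finite_Int disjI1 finite_PiE) auto
    fix w assume "w \<in> (\<lambda>v. restrict v {1..m}) ` ?H (Suc m)"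
    then have "w \<in> ?H m" unfolding img .
    then show "card {v \<in> ?H (Suc m). restrict v {1..m} = w} = k"
      unfolding k_def fibre[OF \<open>w \<in> ?H m\<close>, symmetric] using tot(2) by simp
  qed
  moreover have "k * totient (nat ?d) = totient (nat M)"
  proof -
    have "nat ?d dvd nat M" using d by (simp add: nat_dvd_iff)
    then show ?thesis unfolding k_def by (intro dvd_div_mult_self totient_dvd)
  qed
  ultimately have "card (?H (Suc m)) * totient (nat ?d) = totient (nat M) * card (?H m)"
    unfolding img by (simp add: mult_ac)
  then have "card (?H (Suc m)) * totient (nat ?d) * (\<Prod>j=1..m. totient (nat (newton_step a j)))
      = totient (nat M) * totient (nat M) ^ m"
    using IH by (simp add: mult.assoc)
  then show ?case by (simp add: prod.nat_ivl_Suc' mult_ac)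
qed

text \<open>The unit group modulo 1, 2, 3 or 6 consists of \<open>1\<close> and \<open>-1\<close>.\<close>
lemma cong_or_cong_minus_if_dvd_6:
  fixes x y d :: int
  assumes "d > 0" "d dvd 6" "coprime x d" "coprime y d"
  shows "[x = y] (mod d) \<or> [x = - y] (mod d)"
proof -
  have dvd: "\<not> c dvd z" if "coprime z d" "c dvd d" "\<not> c dvd 1" for c z
    using that coprime_common_divisor by blast
  have "d \<le> 6" using assms(2) zdvd_imp_le by auto
  with assms(1) have "d = 1 \<or> d = 2 \<or> d = 3 \<or> d = 4 \<or> d = 5 \<or> d = 6" by presburger
  with assms(2) consider "d = 1" | "d = 2" | "d = 3" | "d = 6" by auto
  then have "d dvd x - y \<or> d dvd x + y"
  proof cases
    case 2
    with dvd[of _ 2] assms show ?thesis by auto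
  next
    case 3
    with dvd[of _ 3] assms have "\<not> 3 dvd x" "\<not> 3 dvd y" by auto
    then show ?thesis unfolding 3 by presburger
  next
    case 4
    with dvd[of _ 2] dvd[of _ 3] assms have "\<not> 3 dvd x" "\<not> 3 dvd y" "odd x" "odd y" by auto
    then show ?thesis unfolding 4 by presburger
  qed simp
  then show ?thesis by (simp add: cong_iff_dvd_diff)
qed

text \<open>The value forced on the next coordinate and the given coordinate are both units modulo a divisor of 6, so
  they agree up to a sign, and this sign is chosen.\<close>
lemma signs_into_node_values:
  assumes "inj_on a {1..m}"
    and "\<And>j. j \<in> {1..m} \<Longrightarrow> newton_step a j > 0 \<and> newton_step a j dvd M \<and> newton_step a j dvd 6"
    and "\<And>i. i \<in> {1..m} \<Longrightarrow> coprime (u i) M"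
  shows "\<exists>e. (\<forall>i. e i \<in> {1, -1}) \<and> (\<lambda>i. e i * u i) \<in> node_values m a"
  using assms
proof (induction m)
  case 0
  show ?case by (intro exI[of _ "\<lambda>_. 1"]) (auto simp: node_values_def)
next
  case (Suc m)
  let ?d = "newton_step a (Suc m)"
  have inj: "inj_on a {1..m}" using Suc.prems(1) by (auto simp: inj_on_def)
  have d: "?d > 0" "?d dvd M" "?d dvd 6" using Suc.prems(2)[of "Suc m"] by auto
  have "\<exists>e. (\<forall>i. e i \<in> {1, -1}) \<and> (\<lambda>i. e i * u i) \<in> node_values m a"
    by (rule Suc.IH[OF inj]) (use Suc.prems in auto)
  then obtain e g where e: "\<And>i. e i \<in> {1, -1}" and g: "\<And>i. i \<in> {1..m} \<Longrightarrow> poly g (a i) = e i * u i"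
    unfolding node_values_def by blast
  have "coprime (poly g (a i)) M" if "i \<in> {1..m}" for i
    using e[of i] Suc.prems(3)[of i] g[OF that] that by auto
  then have "coprime (poly g (a (Suc m))) ?d" by (rule coprime_newton_step[OF _ d(2)])
  moreover have "coprime (u (Suc m)) ?d"
    using coprime_divisors[OF dvd_refl d(2) Suc.prems(3)[of "Suc m"]] by auto
  ultimately have "[u (Suc m) = poly g (a (Suc m))] (mod ?d) \<or> [- u (Suc m) = poly g (a (Suc m))] (mod ?d)"
    using cong_or_cong_minus_if_dvd_6[OF d(1,3)] cong_sym by blast
  then have "[1 * u (Suc m) = poly g (a (Suc m))] (mod ?d) \<or> [(- 1) * u (Suc m) = poly g (a (Suc m))] (mod ?d)"
    by simp
  then obtain s where s: "s \<in> {1, -1}" "[s * u (Suc m) = poly g (a (Suc m))] (mod ?d)" by blast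
  have "(\<lambda>i. (e(Suc m := s)) i * u i) \<in> node_values (Suc m) a"
    by (subst node_values_Suc_iff[OF Suc.prems(1), where g = g]) (use g s in auto)
  then show ?case using e s(1) by (intro exI[of _ "e(Suc m := s)"]) auto
qed

text \<open>These tuples are the units of \<open>R\<close>. Their entries differ by at most 2, while \<open>g(a\<^sub>n) - g(a\<^sub>1)\<close> is divisible by
  \<open>a\<^sub>n - a\<^sub>1 \<ge> 4\<close>, so the two extreme entries agree. For any other node, \<open>g - g(a\<^sub>1)\<close> is then divisible by
  \<open>(x - a\<^sub>1) (x - a\<^sub>n)\<close>, whose value there is at least 3 in absolute value.\<close>
lemma unit_node_values_constant:
  assumes mono: "strict_mono_on {1..n} a" and "n \<ge> 2" and diam: "a n - a 1 \<ge> 4"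
    and e: "\<And>i. i \<in> {1..n} \<Longrightarrow> e i \<in> {1, -1}" "e \<in> node_values n a" and i: "i \<in> {1..n}"
  shows "e i = e 1"
proof -
  obtain g where g: "\<And>i. i \<in> {1..n} \<Longrightarrow> poly g (a i) = e i"
    using e(2) unfolding node_values_def by blast
  have n: "1 \<in> {1..n}" "n \<in> {1..n}" using assms(2) by auto
  have small: "x = 0" if "d dvd x" "\<bar>d\<bar> > 2" "\<bar>x\<bar> \<le> 2" for d x :: int
    using that zdvd_not_zless[of "\<bar>x\<bar>" "\<bar>d\<bar>"] by (cases "x = 0") auto
  have diff: "\<bar>e i - e j\<bar> \<le> 2" if "i \<in> {1..n}" "j \<in> {1..n}" for i j
    using e(1)[OF that(1)] e(1)[OF that(2)] by auto
  have "e n - e 1 = 0"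
  proof (rule small[of "a n - a 1"])
    show "a n - a 1 dvd e n - e 1" using poly_diff_dvd[of "a n" "a 1" g] g n by simp
  qed (use diam diff n in auto)
  then have en: "e n = e 1" by simp
  show ?thesis
  proof (cases "i = 1 \<or> i = n")
    case False
    then have b: "a 1 < a i" "a i < a n" using i n by (auto intro!: strict_mono_onD[OF mono])
    have "a 1 \<noteq> a n" using b by simp
    define p where "p = g - [:e 1:]"
    have "[:- a 1, 1:] dvd p" using g n by (simp add: poly_eq_0_iff_dvd[symmetric] p_def)
    then obtain q where q: "p = [:- a 1, 1:] * q" by (elim dvdE)
    have "poly p (a n) = 0" using g n en by (simp add: p_def)
    then have "poly q (a n) = 0" using \<open>a 1 \<noteq> a n\<close> by (simp add: q)
    then have "[:- a n, 1:] dvd q" by (simp add: poly_eq_0_iff_dvd)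
    then obtain r where r: "q = [:- a n, 1:] * r" by (elim dvdE)
    have "e i - e 1 = poly p (a i)" using g i by (simp add: p_def)
    also have "\<dots> = (a i - a 1) * (a i - a n) * poly r (a i)" unfolding q r poly_mult by simp
    finally have dv: "(a i - a 1) * (a i - a n) dvd e i - e 1" by simp
    \<comment> \<open>A product of two positive integers with sum at least 4 is at least 3.\<close>
    have "(a i - a 1 - 1) * (a n - a i - 1) \<ge> 0" using b by simp
    then have "(a i - a 1) * (a n - a i) \<ge> 3" using diam by (simp add: algebra_simps)
    then have "\<bar>(a i - a 1) * (a i - a n)\<bar> > 2" by (simp add: algebra_simps)
    then have "e i - e 1 = 0" using small[OF dv] diff[OF i n(1)] by simp
    then show ?thesis by simp
  qed (use en in auto)
qed

text \<open>The factors of the Newton step are distinct elements of \<open>{1, 2, 3}\<close>.\<close>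
lemma newton_step_dvd_6:
  assumes mono: "strict_mono_on {1..n} a" and diam: "a n - a 1 < 4" and j: "j \<in> {1..n}"
  shows "newton_step a j dvd 6"
proof -
  have inj: "inj_on (\<lambda>i. a j - a i) {1..<j}"
    by (rule inj_onI) (use inj_onD[OF strict_mono_on_imp_inj_on[OF mono]] j in auto)
  have "newton_step a j = \<Prod>((\<lambda>i. a j - a i) ` {1..<j})"
    unfolding newton_step_def using prod.reindex[OF inj, of "\<lambda>x. x"] by simp
  also have "\<dots> dvd \<Prod>{1, 2, 3}"
  proof (rule prod_dvd_prod_subset)
    have "a j - a i \<in> {1, 2, 3}" if "i \<in> {1..<j}" for i
    proof -
      have "a 1 \<le> a i" "a j \<le> a n"
        using that j by (auto intro!: strict_mono_on_leD[OF mono])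
      moreover have "a i < a j" using that j by (auto intro!: strict_mono_onD[OF mono])
      ultimately show ?thesis using diam by auto
    qed
    then show "(\<lambda>i. a j - a i) ` {1..<j} \<subseteq> {1, 2, 3}" by blast
  qed simp
  finally show ?thesis by simp
qed

section \<open>Newton steps and the numbers \<open>\<Delta>\<^sub>k\<close>\<close>
lemma Delta_set_eq_prod_newton_step: "Delta_set a {1..n} = (\<Prod>j=1..n. newton_step a j)"
proof -
  have "(\<Prod>j=1..n. newton_step a j) = (\<Prod>(j, i)\<in>Sigma {1..n} (\<lambda>j. {1..<j}). a j - a i)"
    unfolding newton_step_def by (rule prod.Sigma) auto
  also have "\<dots> = (\<Prod>(i, j)\<in>{(i, j). i \<in> {1..n} \<and> j \<in> {1..n} \<and> i < j}. a j - a i)"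
    by (rule prod.reindex_bij_witness[where i = "\<lambda>(i, j). (j, i)" and j = "\<lambda>(j, i). (i, j)"]) auto
  finally show ?thesis by (simp add: Delta_set_def)
qed

lemma newton_step_pos:
  assumes "strict_mono_on {1..n} a" and "j \<in> {1..n}"
  shows "newton_step a j > 0"
  unfolding newton_step_def
proof (rule prod_pos)
  fix i assume "i \<in> {1..<j}"
  then show "a j - a i > 0" using assms(2) strict_mono_onD[OF assms(1), of i j] by auto
qed

lemma prime_dvd_Delta_set_iff:
  assumes "prime p" and "finite S"
  shows "int p dvd Delta_set a S \<longleftrightarrow> \<not> inj_on (\<lambda>i. a i mod int p) S"
proof -
  let ?T = "{(i, j). i \<in> S \<and> j \<in> S \<and> i < j}"
  have "finite ?T" by (rule finite_subset[of _ "S \<times> S"]) (use assms(2) in auto)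
  then have "int p dvd Delta_set a S \<longleftrightarrow> (\<exists>(i, j)\<in>?T. int p dvd a j - a i)"
    unfolding Delta_set_def using prime_dvd_prod_iff[of ?T "int p" "\<lambda>(i, j). a j - a i"] assms(1)
    by (auto simp: case_prod_unfold)
  also have "\<dots> \<longleftrightarrow> (\<exists>i\<in>S. \<exists>j\<in>S. i < j \<and> a i mod int p = a j mod int p)"
    by (auto simp: mod_eq_dvd_iff) (metis mod_eq_dvd_iff)+
  also have "\<dots> \<longleftrightarrow> \<not> inj_on (\<lambda>i. a i mod int p) S"
    unfolding inj_on_def by (metis linorder_neq_iff)
  finally show ?thesis .
qed

lemma Delta_pos:
  assumes "strict_mono_on {1..n} a" and "l < n"
  shows "Delta n a l > 0"
proof -
  let ?F = "{S. S \<subseteq> {1..n} \<and> card S = l + 1}"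
  have S: "{1..l+1} \<in> ?F" using assms(2) by auto
  have "Delta_set a {1..l+1} > 0"
    unfolding Delta_set_eq_prod_newton_step
    by (intro prod_pos newton_step_pos[OF assms(1)]) (use assms(2) in auto)
  then have "(GCD S\<in>?F. Delta_set a S) \<noteq> 0"
    unfolding Gcd_0_iff using subsetD[OF _ imageI[OF S, of "Delta_set a"], of "{0}"] by - (intro notI, simp)
  moreover have "(GCD S\<in>?F. Delta_set a S) \<ge> 0" by simp
  ultimately show ?thesis unfolding Delta_def by linarith
qed

text \<open>All sets of \<open>l + 1\<close> nodes contain two nodes that are congruent modulo \<open>p\<close> iff the nodes meet at most \<open>l\<close>
  residue classes.\<close>
lemma prime_dvd_Delta_iff:
  assumes "strict_mono_on {1..n} a" and "l < n" and p: "prime p"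
  shows "p dvd Delta n a l \<longleftrightarrow> card ((\<lambda>i. a i mod int p) ` {1..n}) \<le> l"
proof -
  let ?F = "{S. S \<subseteq> {1..n} \<and> card S = l + 1}" and ?r = "\<lambda>i. a i mod int p"
  have "p dvd Delta n a l \<longleftrightarrow> int p dvd (GCD S\<in>?F. Delta_set a S)"
    unfolding Delta_def by (subst int_dvd_int_iff[symmetric]) simp
  also have "\<dots> \<longleftrightarrow> (\<forall>S\<in>?F. int p dvd Delta_set a S)" by (auto simp: dvd_Gcd_iff)
  also have "\<dots> \<longleftrightarrow> (\<forall>S\<in>?F. \<not> inj_on ?r S)"
  proof (rule ball_cong)
    fix S assume "S \<in> ?F"
    then have "finite S" by (auto intro: finite_subset)
    then show "int p dvd Delta_set a S \<longleftrightarrow> \<not> inj_on ?r S" by (rule prime_dvd_Delta_set_iff[OF p])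
  qed simp
  also have "\<dots> \<longleftrightarrow> card (?r ` {1..n}) \<le> l"
  proof
    assume *: "\<forall>S\<in>?F. \<not> inj_on ?r S"
    show "card (?r ` {1..n}) \<le> l"
    proof (rule ccontr)
      assume "\<not> card (?r ` {1..n}) \<le> l"
      moreover obtain T where T: "T \<subseteq> {1..n}" "inj_on ?r T" "?r ` {1..n} = ?r ` T"
        using subset_image_inj[THEN iffD1, OF order_refl, of "{1..n}" ?r] by blast
      ultimately have "l + 1 \<le> card T" by (simp add: card_image)
      then obtain S where "S \<subseteq> T" "card S = l + 1" by (meson obtain_subset_with_card_n)
      then show False using * T(1) inj_on_subset[OF T(2)] by blast
    qed
  next
    assume *: "card (?r ` {1..n}) \<le> l"
    show "\<forall>S\<in>?F. \<not> inj_on ?r S"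
    proof (intro ballI notI)
      fix S assume S: "S \<in> ?F" and inj: "inj_on ?r S"
      have "card (?r ` S) \<le> card (?r ` {1..n})" using S by (intro card_mono image_mono) auto
      then show False using * S card_image[OF inj] by auto
    qed
  qed
  finally show ?thesis .
qed

text \<open>The remaining indices are the first occurrences of their values, and there is one of them for each value.\<close>
lemma card_repeated_values:
  fixes f :: "nat \<Rightarrow> 'b"
  shows "card {j \<in> {1..n}. \<exists>i\<in>{1..<j}. f j = f i} = n - card (f ` {1..n})"
proof -
  let ?R = "{j \<in> {1..n}. \<exists>i\<in>{1..<j}. f j = f i}"
  have inj: "inj_on f ({1..n} - ?R)"
  proof (rule inj_onI)
    fix x y assume xy: "x \<in> {1..n} - ?R" "y \<in> {1..n} - ?R" "f x = f y"
    have "x \<notin> {1..<y}" using xy(2) xy(3)[symmetric] by blast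
    moreover have "y \<notin> {1..<x}" using xy(1,3) by blast
    ultimately show "x = y" using xy(1,2) by auto
  qed
  have "f ` ({1..n} - ?R) = f ` {1..n}"
  proof
    show "f ` ({1..n} - ?R) \<subseteq> f ` {1..n}" by blast
    show "f ` {1..n} \<subseteq> f ` ({1..n} - ?R)"
    proof
      fix y assume "y \<in> f ` {1..n}"
      then obtain k where k: "k \<in> {1..n}" "f k = y" by blast
      define j where "j = (LEAST j. j \<in> {1..n} \<and> f j = y)"
      have j: "j \<in> {1..n} \<and> f j = y" unfolding j_def by (rule LeastI[of _ k]) (use k in simp)
      have "j \<notin> ?R"
      proof
        assume "j \<in> ?R"
        then obtain i where "i \<in> {1..<j}" "f i = y" using j by fastforce
        then show False using not_less_Least[of i "\<lambda>j. j \<in> {1..n} \<and> f j = y"] j unfolding j_def[symmetric] by auto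
      qed
      then show "y \<in> f ` ({1..n} - ?R)" using j by blast
    qed
  qed
  then have "card ({1..n} - ?R) = card (f ` {1..n})" using card_image[OF inj] by simp
  moreover have "card ({1..n} - ?R) = n - card ?R" by (subst card_Diff_subset) auto
  moreover have "card ?R \<le> card {1..n}" by (rule card_mono) auto
  ultimately show ?thesis by simp
qed

text \<open>Expands \<open>\<phi>(k)/k = \<Prod> (1 - 1/p)\<close> in every factor and collects the factors that belong to the same prime.\<close>
lemma prod_totient_ratio:
  fixes k :: "'b \<Rightarrow> nat"
  assumes "finite J" and "finite P" and k: "\<And>j. j \<in> J \<Longrightarrow> k j > 0 \<and> prime_factors (k j) \<subseteq> P"
    and P: "\<And>p. p \<in> P \<Longrightarrow> prime p"
  shows "(\<Prod>j\<in>J. real (totient (k j)) / real (k j)) = (\<Prod>p\<in>P. (1 - 1 / real p) ^ card {j \<in> J. p dvd k j})"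
proof -
  have "real (totient (k j)) / real (k j) = (\<Prod>p\<in>P. if p dvd k j then 1 - 1 / real p else 1)" if j: "j \<in> J" for j
  proof -
    have "real (totient (k j)) / real (k j) = (\<Prod>p\<in>prime_factors (k j). 1 - 1 / real p)"
      using k[OF j] by (simp add: totient_formula2)
    also have "\<dots> = (\<Prod>p\<in>P. if p dvd k j then 1 - 1 / real p else 1)"
    proof (rule prod.mono_neutral_cong_left)
      show "\<forall>i\<in>P - prime_factors (k j). (if i dvd k j then 1 - 1 / real i else 1) = 1"
        using P k[OF j] by (auto simp: in_prime_factors_iff)
    qed (use k[OF j] assms(2) in auto)
    finally show ?thesis .
  qed
  then have "(\<Prod>j\<in>J. real (totient (k j)) / real (k j)) = (\<Prod>j\<in>J. \<Prod>p\<in>P. if p dvd k j then 1 - 1 / real p else 1)"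
    by simp
  also have "\<dots> = (\<Prod>p\<in>P. \<Prod>j\<in>J. if p dvd k j then 1 - 1 / real p else 1)" by (rule prod.swap)
  also have "\<dots> = (\<Prod>p\<in>P. (1 - 1 / real p) ^ card {j \<in> J. p dvd k j})"
    using assms(1) by (simp add: prod.If_cases Int_def conj_commute)
  finally show ?thesis .
qed

text \<open>Division of both sides by \<open>\<Delta>\<^sub>n\<^sub>-\<^sub>1 = \<Prod> d\<^sub>j\<close> turns them into products of ratios \<open>\<phi>(k)/k\<close>, and these are
  compared prime by prime. The number of residue classes that the nodes meet modulo \<open>p\<close> is called the rank of
  \<open>p\<close> in the proof.\<close>
lemma prod_totient_newton_step:
  assumes mono: "strict_mono_on {1..n} a" and n: "n \<ge> 2"
  shows "real (\<Prod>j=1..n. totient (nat (newton_step a j))) =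
    real (totient (Delta n a (n - 1))) * (\<Prod>l=1..n - 2. real (totient (Delta n a l)) / real (Delta n a l))"
proof -
  let ?D = "\<lambda>l. Delta n a l" and ?k = "\<lambda>j. nat (newton_step a j)"
  let ?rank = "\<lambda>p. card ((\<lambda>i. a i mod int p) ` {1..n})"
  have pos: "newton_step a j > 0" if "j \<in> {1..n}" for j using newton_step_pos[OF mono that] .
  have "int (?D (n - 1)) = (\<Prod>j=1..n. newton_step a j)"
    using Delta_top[OF _ mono] n by (simp only: Delta_set_eq_prod_newton_step)
  also have "\<dots> = int (\<Prod>j=1..n. ?k j)"
    unfolding of_nat_prod by (rule prod.cong) (use pos in \<open>auto intro: less_imp_le\<close>)
  finally have top: "?D (n - 1) = (\<Prod>j=1..n. ?k j)" by (simp only: of_nat_eq_iff)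
  have Dpos: "?D l > 0" if "l < n" for l using Delta_pos[OF mono that] .
  define P where "P = prime_factors (?D (n - 1))"
  have P: "prime p" if "p \<in> P" for p using that by (auto simp: P_def)
  have rank: "?rank p \<ge> 1" "?rank p \<le> n" for p
    using n card_image_le[of "{1..n}"  "\<lambda>i. a i mod int p"] by (auto simp: Suc_le_eq card_gt_0_iff)
  have eq1: "(\<Prod>j=1..n. real (totient (?k j)) / real (?k j)) = (\<Prod>p\<in>P. (1 - 1 / real p) ^ (n - ?rank p))"
  proof -
    have sub: "0 < ?k j \<and> prime_factors (?k j) \<subseteq> P" if "j \<in> {1..n}" for j
    proof -
      have "?k j dvd ?D (n - 1)" unfolding top using that by (intro dvd_prodI) auto
      moreover have "?D (n - 1) \<noteq> 0" using Dpos[of "n - 1"] n by simp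
      ultimately have "prime_factors (?k j) \<subseteq> P" unfolding P_def by (intro dvd_prime_factors)
      then show ?thesis using pos[OF that] by simp
    qed
    have "card {j \<in> {1..n}. p dvd ?k j} = n - ?rank p" if "p \<in> P" for p
    proof -
      have "p dvd ?k j \<longleftrightarrow> (\<exists>i\<in>{1..<j}. a j mod int p = a i mod int p)" if j: "j \<in> {1..n}" for j
      proof -
        have "p dvd ?k j \<longleftrightarrow> int p dvd newton_step a j"
          by (subst int_dvd_int_iff[symmetric]) (use pos[OF j] in simp)
        also have "\<dots> \<longleftrightarrow> (\<exists>i\<in>{1..<j}. int p dvd a j - a i)"
          unfolding newton_step_def using P[OF \<open>p \<in> P\<close>] by (intro prime_dvd_prod_iff) auto
        finally show ?thesis by (simp only: mod_eq_dvd_iff)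
      qed
      then have "{j \<in> {1..n}. p dvd ?k j} = {j \<in> {1..n}. \<exists>i\<in>{1..<j}. a j mod int p = a i mod int p}" by blast
      then show ?thesis using card_repeated_values[of n "\<lambda>i. a i mod int p"] by simp
    qed
    then show ?thesis by (subst prod_totient_ratio[OF _ _ sub P]) (auto simp: P_def)
  qed
  have eq2: "(\<Prod>l=1..n-1. real (totient (?D l)) / real (?D l)) = (\<Prod>p\<in>P. (1 - 1 / real p) ^ (n - ?rank p))"
  proof -
    have sub: "0 < ?D l \<and> prime_factors (?D l) \<subseteq> P" if "l \<in> {1..n-1}" for l
    proof -
      have "l < n" "n - 1 < n" using that n by auto
      have "p \<in> P" if p: "p \<in> prime_factors (?D l)" for p
      proof -
        have "prime p" "p dvd ?D l" using p by auto
        then have "?rank p \<le> l" using prime_dvd_Delta_iff[OF mono \<open>l < n\<close>] by simp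
        then have "p dvd ?D (n - 1)"
          using prime_dvd_Delta_iff[OF mono \<open>n - 1 < n\<close> \<open>prime p\<close>] \<open>l < n\<close> by simp
        then show ?thesis unfolding P_def using Dpos[OF \<open>n - 1 < n\<close>] \<open>prime p\<close> by (simp add: in_prime_factors_iff)
      qed
      then show ?thesis using Dpos \<open>l < n\<close> by blast
    qed
    have "card {l \<in> {1..n-1}. p dvd ?D l} = n - ?rank p" if "p \<in> P" for p
    proof -
      have "p dvd ?D l \<longleftrightarrow> ?rank p \<le> l" if "l \<in> {1..n-1}" for l
        using prime_dvd_Delta_iff[OF mono _ P[OF \<open>p \<in> P\<close>], of l] that by auto
      then have "{l \<in> {1..n-1}. p dvd ?D l} = {?rank p..n-1}" using rank[of p] by auto
      then show ?thesis using n by simp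
    qed
    then show ?thesis by (subst prod_totient_ratio[OF _ _ sub P]) (auto simp: P_def)
  qed
  have "real (\<Prod>j=1..n. totient (?k j)) = (\<Prod>j=1..n. real (totient (?k j)) / real (?k j)) * real (?D (n - 1))"
    unfolding top of_nat_prod prod.distrib[symmetric] by (rule prod.cong) (use pos in auto)
  also have "\<dots> = (\<Prod>l=1..n-1. real (totient (?D l)) / real (?D l)) * real (?D (n - 1))"
    unfolding eq1 eq2 ..
  also have "{1..n-1} = insert (n - 1) {1..n-2}" using n by auto
  also have "(\<Prod>l\<in>insert (n - 1) {1..n-2}. real (totient (?D l)) / real (?D l)) * real (?D (n - 1))
     = real (totient (?D (n - 1))) * (\<Prod>l=1..n - 2. real (totient (?D l)) / real (?D l))"
    using n Dpos[of "n - 1"] by (subst prod.insert) auto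
  finally show ?thesis .
qed

section \<open>Lattices of integer tuples\<close>
lemma int_subgroup_generator:
  fixes S :: "int set"
  assumes "m \<in> S" "m \<noteq> 0" and diff: "\<And>x y. x \<in> S \<Longrightarrow> y \<in> S \<Longrightarrow> x - y \<in> S"
  obtains d where "d \<in> S" "d > 0" "\<And>x. x \<in> S \<Longrightarrow> d dvd x"
proof -
  have zero: "0 \<in> S" using diff[OF assms(1) assms(1)] by simp
  have minus: "- x \<in> S" if "x \<in> S" for x using diff[OF zero that] by simp
  have add: "x + y \<in> S" if "x \<in> S" "y \<in> S" for x y using diff[OF that(1) minus[OF that(2)]] by simp
  have multn: "int k * x \<in> S" if "x \<in> S" for k x
    by (induction k) (auto simp: zero algebra_simps intro: add that)
  have mult: "k * x \<in> S" if "x \<in> S" for k x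
    using multn[OF that, of "nat \<bar>k\<bar>"] minus by (cases "k \<ge> 0") force+
  define P where "P = (\<lambda>k::nat. k > 0 \<and> int k \<in> S)"
  have "P (nat \<bar>m\<bar>)" using assms(1,2) minus[OF assms(1)] by (auto simp: P_def abs_if)
  then have "P (LEAST k. P k)" by (rule LeastI)
  define d where "d = int (LEAST k. P k)"
  have d: "d \<in> S" "d > 0" using \<open>P (LEAST k. P k)\<close> by (auto simp: d_def P_def)
  have "d dvd x" if x: "x \<in> S" for x
  proof (rule ccontr)
    assume "\<not> d dvd x"
    then have "x mod d > 0" using d(2) by (metis mod_eq_0_iff_dvd order_le_less pos_mod_sign)
    moreover have "x mod d \<in> S" using diff[OF x mult[OF d(1), of "x div d"]] by (simp add: minus_div_mult_eq_mod)
    ultimately have "P (nat (x mod d))" by (simp add: P_def)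
    then have "(LEAST k. P k) \<le> nat (x mod d)" by (rule Least_le)
    moreover have "x mod d < d" using d(2) by simp
    ultimately show False using d(2) unfolding d_def by linarith
  qed
  then show thesis using that d by blast
qed

text \<open>A Hermite normal form. The vectors of \<open>W\<close> whose coordinates before \<open>k\<close> vanish have \<open>k\<close>-th coordinates that form
  a subgroup of \<open>\<int>\<close> containing \<open>M \<noteq> 0\<close>; as \<open>b k\<close> serves any such vector whose \<open>k\<close>-th coordinate generates
  this subgroup. Subtracting multiples of \<open>b 1, b 2, \<dots>\<close> clears the coordinates of a given vector in turn.\<close>
lemma triangular_lattice_basis:
  fixes W :: "(nat \<Rightarrow> int) set"
  assumes diff: "\<And>v w. v \<in> W \<Longrightarrow> w \<in> W \<Longrightarrow> (\<lambda>i. v i - w i) \<in> W"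
    and "M \<noteq> 0" and conductor: "\<And>w. (\<lambda>i. M * w i) \<in> W"
  obtains b where "\<And>k. b k \<in> W" "\<And>k i. i \<in> {1..<k} \<Longrightarrow> b k i = 0" "\<And>k. b k k \<noteq> 0"
    and "\<And>w. w \<in> W \<Longrightarrow> \<exists>c. \<forall>i\<in>{1..n}. w i = (\<Sum>k=1..n. c k * b k i)"
proof -
  define L where "L = (\<lambda>k. {w \<in> W. \<forall>i\<in>{1..<k}. w i = 0})"
  have "\<exists>b. b \<in> L k \<and> b k \<noteq> 0 \<and> (\<forall>w\<in>L k. b k dvd w k)" for k
  proof -
    let ?e = "\<lambda>i. M * (if i = k then 1 else 0)"
    have "?e \<in> L k" using conductor[of "\<lambda>i. if i = k then 1 else 0"] by (auto simp: L_def)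
    then have 1: "M \<in> (\<lambda>w. w k) ` L k" by (rule rev_image_eqI) simp
    have 2: "x - y \<in> (\<lambda>w. w k) ` L k" if xy: "x \<in> (\<lambda>w. w k) ` L k" "y \<in> (\<lambda>w. w k) ` L k" for x y
    proof -
      obtain v w where vw: "v \<in> L k" "w \<in> L k" "x = v k" "y = w k" using xy by blast
      then have "(\<lambda>i. v i - w i) \<in> L k" using diff by (auto simp: L_def)
      then show ?thesis by (rule rev_image_eqI) (simp add: vw)
    qed
    obtain d where d: "d \<in> (\<lambda>w. w k) ` L k" "d > 0" "\<And>x. x \<in> (\<lambda>w. w k) ` L k \<Longrightarrow> d dvd x"
      using int_subgroup_generator[OF 1 \<open>M \<noteq> 0\<close> 2] by blast
    then obtain b where "b \<in> L k" "d = b k" by blast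
    then show ?thesis using d by (intro exI[of _ b]) auto
  qed
  then obtain b where b: "\<And>k. b k \<in> L k" "\<And>k. b k k \<noteq> 0" "\<And>k w. w \<in> L k \<Longrightarrow> b k k dvd w k"
    by metis
  have zero: "(\<lambda>i. 0) \<in> W" using conductor[of "\<lambda>_. 0"] by simp
  have add: "(\<lambda>i. v i + w i) \<in> W" if "v \<in> W" "w \<in> W" for v w
    using diff[OF that(1) diff[OF zero that(2)]] by simp
  have multn: "(\<lambda>i. int k * w i) \<in> W" if "w \<in> W" for k w
  proof (induction k)
    case (Suc k)
    then show ?case using add[OF Suc that] by (simp add: algebra_simps)
  qed (simp add: zero)
  have mult: "(\<lambda>i. k * w i) \<in> W" if "w \<in> W" for k w
    using multn[OF that, of "nat \<bar>k\<bar>"] diff[OF zero multn[OF that, of "nat \<bar>k\<bar>"]] by (cases "k \<ge> 0") simp_all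
  have span: "\<exists>c. (\<lambda>i. w i - (\<Sum>k=1..m. c k * b k i)) \<in> L (Suc m)" if w: "w \<in> W" for w m
  proof (induction m)
    case 0
    then show ?case using w by (simp add: L_def)
  next
    case (Suc m)
    then obtain c where c: "(\<lambda>i. w i - (\<Sum>k=1..m. c k * b k i)) \<in> L (Suc m)" (is "?w' \<in> _") by blast
    obtain t where t: "?w' (Suc m) = b (Suc m) (Suc m) * t" using b(3)[OF c] by (elim dvdE)
    define c' where "c' = c(Suc m := t)"
    have eq: "w i - (\<Sum>k=1..Suc m. c' k * b k i) = ?w' i - t * b (Suc m) i" for i
      by (simp add: c'_def)
    have "(\<lambda>i. ?w' i - t * b (Suc m) i) \<in> W"
    proof (rule diff[OF _ mult])
      show "?w' \<in> W" using c by (simp only: L_def mem_Collect_eq)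
      show "b (Suc m) \<in> W" using b(1)[of "Suc m"] by (simp add: L_def)
    qed
    moreover have "?w' i - t * b (Suc m) i = 0" if "i \<in> {1..<Suc (Suc m)}" for i
    proof (cases "i = Suc m")
      case True
      show ?thesis using t unfolding True by (simp add: mult.commute)
    next
      case False
      then have "i \<in> {1..<Suc m}" using that by auto
      then show ?thesis using c b(1)[of "Suc m"] by (auto simp: L_def)
    qed
    ultimately have "(\<lambda>i. ?w' i - t * b (Suc m) i) \<in> L (Suc (Suc m))" by (simp add: L_def)
    then show ?case unfolding eq[symmetric] by blast
  qed
  show thesis
  proof (rule that[of b])
    show "b k \<in> W" "\<And>i. i \<in> {1..<k} \<Longrightarrow> b k i = 0" for k using b(1)[of k] by (auto simp: L_def)
    show "b k k \<noteq> 0" for k by (rule b(2))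
    show "\<exists>c. \<forall>i\<in>{1..n}. w i = (\<Sum>k=1..n. c k * b k i)" if "w \<in> W" for w
    proof -
      obtain c where "(\<lambda>i. w i - (\<Sum>k=1..n. c k * b k i)) \<in> L (Suc n)" using span[OF \<open>w \<in> W\<close>] by blast
      then show ?thesis by (intro exI[of _ c]) (auto simp: L_def)
    qed
  qed
qed

lemma triangular_independent:
  fixes b :: "nat \<Rightarrow> nat \<Rightarrow> int"
  assumes tri: "\<And>k i. i \<in> {1..<k} \<Longrightarrow> b k i = 0" and diag: "\<And>k. b k k \<noteq> 0"
    and zero: "\<And>i. i \<in> {1..n} \<Longrightarrow> (\<Sum>k=1..n. c k * b k i) = 0" and "j \<in> {1..n}"
  shows "c j = 0"
  using \<open>j \<in> {1..n}\<close>
proof (induction j rule: less_induct)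
  case (less j)
  have "c k * b k j = 0" if "k \<in> {1..n} - {j}" for k
    using less that tri[of j k] by (cases "k < j") auto
  then have "(\<Sum>k=1..n. c k * b k j) = c j * b j j"
    using less.prems by (subst sum.remove[of _ j]) (simp_all add: sum.neutral)
  then show ?case using zero[OF less.prems] diag by simp
qed

section \<open>The algebra \<open>K\<close> as \<open>\<rat>\<^sup>n\<close>\<close>
locale integer_nodes =
  fixes n :: nat and a :: "nat \<Rightarrow> int"
  assumes mono: "strict_mono_on {1..n} a"
begin

abbreviation K where "K \<equiv> K_alg (chi n a)"

text \<open>The inverse of the isomorphism \<open>K \<cong> \<rat>\<^sup>n\<close> given by evaluation at the nodes. Any interpolating polynomial may be
  chosen, because two of them differ by a multiple of \<open>\<chi>\<close>.\<close>
definition tup :: "(nat \<Rightarrow> rat) \<Rightarrow> rat poly set" where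
  "tup v = K_class (chi n a) (SOME q. \<forall>i\<in>{1..n}. poly q (of_int (a i)) = v i)"

lemma inj_nodes: "inj_on a {1..n}"
  using mono by (rule strict_mono_on_imp_inj_on)

lemma inj_rat_nodes: "inj_on (\<lambda>i. rat_of_int (a i)) {1..n}"
  by (rule inj_onI) (use inj_onD[OF inj_nodes] in simp)

lemma map_poly_chi: "map_poly rat_of_int (chi m a) = (\<Prod>i=1..m. [:- rat_of_int (a i), 1:])"
proof (induction m)
  case 0
  then show ?case by (simp add: chi_def)
next
  case (Suc m)
  have hom: "map_poly rat_of_int (p * q) = map_poly of_int p * map_poly of_int q" for p q
    by (rule poly_eqI) (simp add: coeff_map_poly coeff_mult)
  have "chi (Suc m) a = [:- a (Suc m), 1:] * chi m a" unfolding chi_def by (rule prod.nat_ivl_Suc') simp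
  then have "map_poly rat_of_int (chi (Suc m) a) = [:- rat_of_int (a (Suc m)), 1:] * map_poly rat_of_int (chi m a)"
    by (simp only: hom) (simp add: map_poly_pCons)
  also have "\<dots> = (\<Prod>i=1..Suc m. [:- rat_of_int (a i), 1:])"
    unfolding Suc by (rule prod.nat_ivl_Suc'[symmetric]) simp
  finally show ?case .
qed

lemma poly_map_of_int: "poly (map_poly rat_of_int p) (of_int x) = of_int (poly p x)"
  by (induction p) (auto simp: map_poly_pCons)

lemma K_class_eq: "K_class (chi n a) p = K_class (chi n a) q \<longleftrightarrow>
    (\<forall>i\<in>{1..n}. poly p (of_int (a i)) = poly q (of_int (a i)))"
  unfolding K_class_eq_iff map_poly_chi prod_linear_dvd_iff[OF inj_rat_nodes] by simp

lemma tup_eq_K_class: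
  assumes "\<And>i. i \<in> {1..n} \<Longrightarrow> poly q (of_int (a i)) = v i"
  shows "tup v = K_class (chi n a) q"
proof -
  have "\<forall>i\<in>{1..n}. poly (SOME q. \<forall>i\<in>{1..n}. poly q (of_int (a i)) = v i) (of_int (a i)) = v i"
    by (rule someI[of _ q]) (intro ballI assms)
  then show ?thesis unfolding tup_def K_class_eq using assms by simp
qed

lemma tup_obtain_poly:
  obtains q where "\<And>i. i \<in> {1..n} \<Longrightarrow> poly q (of_int (a i)) = v i" "tup v = K_class (chi n a) q"
proof -
  obtain q where q: "\<forall>i\<in>{1..n}. poly q (of_int (a i)) = v i"
    using interpolation_exists[OF inj_rat_nodes, of v] ..
  have "tup v = K_class (chi n a) q" by (rule tup_eq_K_class) (use q in simp)
  then show thesis by (rule that[rotated]) (use q in simp)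
qed

lemma tup_eq_iff: "tup u = tup v \<longleftrightarrow> (\<forall>i\<in>{1..n}. u i = v i)"
proof -
  obtain p where "\<And>i. i \<in> {1..n} \<Longrightarrow> poly p (of_int (a i)) = u i" "tup u = K_class (chi n a) p"
    using tup_obtain_poly[of u] by metis
  moreover obtain q where "\<And>i. i \<in> {1..n} \<Longrightarrow> poly q (of_int (a i)) = v i" "tup v = K_class (chi n a) q"
    using tup_obtain_poly[of v] by metis
  ultimately show ?thesis by (simp add: K_class_eq)
qed

lemma carrier_K: "carrier K = range tup"
proof -
  have "K_class (chi n a) q = tup (\<lambda>i. poly q (of_int (a i)))" for q by (simp add: tup_eq_K_class)
  moreover have "tup v \<in> range (K_class (chi n a))" for v by (rule tup_obtain_poly[of v]) simp
  ultimately show ?thesis by (auto simp: K_alg_def carrier_K_ring)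
qed

lemma tup_mult: "tup u \<otimes>\<^bsub>K\<^esub> tup v = tup (\<lambda>i. u i * v i)"
proof -
  obtain p where "\<And>i. i \<in> {1..n} \<Longrightarrow> poly p (of_int (a i)) = u i" "tup u = K_class (chi n a) p"
    using tup_obtain_poly[of u] by metis
  moreover obtain q where "\<And>i. i \<in> {1..n} \<Longrightarrow> poly q (of_int (a i)) = v i" "tup v = K_class (chi n a) q"
    using tup_obtain_poly[of v] by metis
  ultimately show ?thesis
    by (subst tup_eq_K_class[of "p * q"]) (auto simp: K_alg_def K_ring_class_simps)
qed

lemma tup_add: "tup u \<oplus>\<^bsub>K\<^esub> tup v = tup (\<lambda>i. u i + v i)"
proof -
  obtain p where "\<And>i. i \<in> {1..n} \<Longrightarrow> poly p (of_int (a i)) = u i" "tup u = K_class (chi n a) p"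
    using tup_obtain_poly[of u] by metis
  moreover obtain q where "\<And>i. i \<in> {1..n} \<Longrightarrow> poly q (of_int (a i)) = v i" "tup v = K_class (chi n a) q"
    using tup_obtain_poly[of v] by metis
  ultimately show ?thesis
    by (subst tup_eq_K_class[of "p + q"]) (auto simp: K_alg_def K_ring_class_simps)
qed

lemma tup_one: "\<one>\<^bsub>K\<^esub> = tup (\<lambda>_. 1)"
  by (subst tup_eq_K_class[of 1]) (auto simp: K_alg_def K_ring_class_simps)

text \<open>Zero is the only idempotent of the additive group.\<close>
lemma tup_zero: "\<zero>\<^bsub>K\<^esub> = tup (\<lambda>_. 0)"
proof -
  interpret M: module "R_ring (chi n a)" K by (rule module_K_alg)
  have "tup (\<lambda>_. 0) \<oplus>\<^bsub>K\<^esub> tup (\<lambda>_. 0) = tup (\<lambda>_. 0)" by (simp add: tup_add)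
  moreover have "tup (\<lambda>_. 0) \<in> carrier K" by (simp add: carrier_K)
  ultimately show ?thesis by (metis M.add.r_cancel_one')
qed

lemma tup_minus: "\<ominus>\<^bsub>K\<^esub> tup v = tup (\<lambda>i. - v i)"
proof -
  interpret M: module "R_ring (chi n a)" K by (rule module_K_alg)
  have "tup (\<lambda>i. - v i) \<oplus>\<^bsub>K\<^esub> tup v = \<zero>\<^bsub>K\<^esub>" by (simp add: tup_add tup_zero)
  then show ?thesis by (rule M.minus_equality) (simp_all add: carrier_K)
qed

text \<open>Elements of the maximal order \<open>\<int>\<^sup>n\<close>.\<close>
definition itup :: "(nat \<Rightarrow> int) \<Rightarrow> rat poly set" where
  "itup w = tup (\<lambda>i. of_int (w i))"

lemma itup_eq_iff: "itup u = itup v \<longleftrightarrow> (\<forall>i\<in>{1..n}. u i = v i)"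
  by (simp add: itup_def tup_eq_iff)

lemma R_to_K_itup: "R_to_K (chi n a) {q. chi n a dvd q - p} = itup (\<lambda>i. poly p (a i))"
  unfolding R_to_K_coset itup_def by (subst tup_eq_K_class) (auto simp: poly_map_of_int)

lemma smult_tup: "{q. chi n a dvd q - p} \<odot>\<^bsub>K\<^esub> tup v = tup (\<lambda>i. of_int (poly p (a i)) * v i)"
proof -
  have "{q. chi n a dvd q - p} \<odot>\<^bsub>K\<^esub> tup v = itup (\<lambda>i. poly p (a i)) \<otimes>\<^bsub>K\<^esub> tup v"
    unfolding R_to_K_itup[symmetric] by (simp add: K_alg_def)
  then show ?thesis by (simp add: itup_def tup_mult)
qed

lemma unit_ideal_eq: "unit_ideal (chi n a) = itup ` node_values n a"
proof -
  have "unit_ideal (chi n a) = range (\<lambda>p. itup (\<lambda>i. poly p (a i)))"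
    unfolding unit_ideal_def carrier_R_ring image_image R_to_K_itup ..
  also have "\<dots> = itup ` node_values n a"
  proof
    show "range (\<lambda>p. itup (\<lambda>i. poly p (a i))) \<subseteq> itup ` node_values n a"
      using node_values_poly by blast
    show "itup ` node_values n a \<subseteq> range (\<lambda>p. itup (\<lambda>i. poly p (a i)))"
    proof
      fix x assume "x \<in> itup ` node_values n a"
      then obtain v g where "x = itup v" "\<forall>i\<in>{1..n}. poly g (a i) = v i" by (auto simp: node_values_def)
      then show "x \<in> range (\<lambda>p. itup (\<lambda>i. poly p (a i)))" by (intro image_eqI[of _ _ g]) (auto simp: itup_eq_iff)
    qed
  qed
  finally show ?thesis .
qed

lemma Units_K: "tup k \<in> Units K \<longleftrightarrow> (\<forall>i\<in>{1..n}. k i \<noteq> 0)"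
proof
  assume "tup k \<in> Units K"
  then obtain l where "tup k \<otimes>\<^bsub>K\<^esub> tup l = \<one>\<^bsub>K\<^esub>" by (auto simp: Units_def carrier_K)
  then have "\<forall>i\<in>{1..n}. k i * l i = 1" by (simp add: tup_mult tup_one tup_eq_iff)
  then show "\<forall>i\<in>{1..n}. k i \<noteq> 0" by force
next
  assume k: "\<forall>i\<in>{1..n}. k i \<noteq> 0"
  have "tup (\<lambda>i. inverse (k i)) \<otimes>\<^bsub>K\<^esub> tup k = \<one>\<^bsub>K\<^esub>" "tup k \<otimes>\<^bsub>K\<^esub> tup (\<lambda>i. inverse (k i)) = \<one>\<^bsub>K\<^esub>"
    using k by (simp_all add: tup_mult tup_one tup_eq_iff)
  then show "tup k \<in> Units K" by (auto simp: Units_def carrier_K)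
qed

lemma l_coset_tup: "tup k <#\<^bsub>K\<^esub> (tup ` L) = tup ` (\<lambda>v i. k i * v i) ` L"
  by (auto simp: l_coset_def tup_mult)

lemma submodule_tupI:
  assumes "(\<lambda>_. 0) \<in> L" and "\<And>u v. u \<in> L \<Longrightarrow> v \<in> L \<Longrightarrow> (\<lambda>i. u i + v i) \<in> L"
    and "\<And>r v. r \<in> node_values n a \<Longrightarrow> v \<in> L \<Longrightarrow> (\<lambda>i. of_int (r i) * v i) \<in> L"
  shows "submodule (tup ` L) (R_ring (chi n a)) K"
proof (rule module.submoduleI[OF module_K_alg])
  show "tup ` L \<subseteq> carrier K" by (auto simp: carrier_K)
  show "\<zero>\<^bsub>K\<^esub> \<in> tup ` L" using assms(1) by (auto simp: tup_zero)
  show "x \<oplus>\<^bsub>K\<^esub> y \<in> tup ` L" if "x \<in> tup ` L" "y \<in> tup ` L" for x y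
    using that assms(2) by (auto simp: tup_add)
  show "r \<odot>\<^bsub>K\<^esub> x \<in> tup ` L" if "r \<in> carrier (R_ring (chi n a))" "x \<in> tup ` L" for r x
    using that assms(3)[OF node_values_poly] by (auto simp: carrier_R_ring smult_tup)
  show "\<ominus>\<^bsub>K\<^esub> x \<in> tup ` L" if "x \<in> tup ` L" for x
    using that assms(3)[OF node_values_const[of "-1"]] by (auto simp: tup_minus)
qed

text \<open>The pullback of a submodule of \<open>K\<close> to \<open>\<rat>\<^sup>n\<close> has the expected closure properties, with \<open>R\<close> acting through
  the values of its polynomials.\<close>
lemma submodule_tupD:
  assumes "submodule I (R_ring (chi n a)) K"
  shows "I = tup ` {v. tup v \<in> I}" and "tup (\<lambda>_. 0) \<in> I"
    and "\<And>u v. tup u \<in> I \<Longrightarrow> tup v \<in> I \<Longrightarrow> tup (\<lambda>i. u i + v i) \<in> I"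
    and "\<And>r v. r \<in> node_values n a \<Longrightarrow> tup v \<in> I \<Longrightarrow> tup (\<lambda>i. of_int (r i) * v i) \<in> I"
proof -
  note E = module.submoduleE[OF module_K_alg assms]
  show "I = tup ` {v. tup v \<in> I}" using E(1) by (auto simp: carrier_K)
  show add: "\<And>u v. tup u \<in> I \<Longrightarrow> tup v \<in> I \<Longrightarrow> tup (\<lambda>i. u i + v i) \<in> I"
    using E(5) by (simp add: tup_add[symmetric])
  show sm: "tup (\<lambda>i. of_int (r i) * v i) \<in> I" if r: "r \<in> node_values n a" and v: "tup v \<in> I" for r v
  proof -
    obtain g where g: "\<And>i. i \<in> {1..n} \<Longrightarrow> poly g (a i) = r i" using r unfolding node_values_def by blast
    have "{q. chi n a dvd q - g} \<odot>\<^bsub>K\<^esub> tup v \<in> I" by (rule E(4)[OF _ v]) (simp add: carrier_R_ring)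
    also have "{q. chi n a dvd q - g} \<odot>\<^bsub>K\<^esub> tup v = tup (\<lambda>i. of_int (r i) * v i)"
      using g by (simp add: smult_tup tup_eq_iff)
    finally show ?thesis .
  qed
  obtain v where "tup v \<in> I" using E(1,2) by (auto simp: carrier_K)
  then show "tup (\<lambda>_. 0) \<in> I" using sm[OF node_values_const[of 0]] by simp
qed

text \<open>An \<open>R\<close>-submodule of \<open>\<int>\<^sup>n\<close> that contains some \<open>M \<int>\<^sup>n\<close> with \<open>M \<noteq> 0\<close> is free of rank \<open>n\<close>, with a triangular
  basis.\<close>
lemma frac_ideal_integer_lattice:
  assumes diff: "\<And>v w. v \<in> W \<Longrightarrow> w \<in> W \<Longrightarrow> (\<lambda>i. v i - w i) \<in> W"
    and "M \<noteq> 0" and conductor: "\<And>w. (\<lambda>i. M * w i) \<in> W"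
    and scale: "\<And>r w. r \<in> node_values n a \<Longrightarrow> w \<in> W \<Longrightarrow> (\<lambda>i. r i * w i) \<in> W"
  shows "frac_ideal (chi n a) (itup ` W)"
proof -
  let ?L = "(\<lambda>w i. rat_of_int (w i)) ` W"
  have zero: "(\<lambda>_. 0) \<in> W" using conductor[of "\<lambda>_. 0"] by simp
  have add: "(\<lambda>i. v i + w i) \<in> W" if "v \<in> W" "w \<in> W" for v w
    using diff[OF that(1) diff[OF zero that(2)]] by simp
  have img: "itup ` W = tup ` ?L" by (auto simp: itup_def image_image)
  have sub: "submodule (itup ` W) (R_ring (chi n a)) K"
    unfolding img
  proof (rule submodule_tupI)
    show "(\<lambda>_. 0) \<in> ?L" using zero by (force intro: image_eqI[of _ _ "\<lambda>_. 0"])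
    show "(\<lambda>i. u i + v i) \<in> ?L" if "u \<in> ?L" "v \<in> ?L" for u v
      using that add by (auto simp flip: of_int_add)
    show "(\<lambda>i. of_int (r i) * v i) \<in> ?L" if "r \<in> node_values n a" "v \<in> ?L" for r v
      using that scale by (auto simp flip: of_int_mult)
  qed
  obtain b where b: "\<And>k. b k \<in> W" "\<And>k i. i \<in> {1..<k} \<Longrightarrow> b k i = 0" "\<And>k. b k k \<noteq> 0"
    and span: "\<And>w. w \<in> W \<Longrightarrow> \<exists>c. \<forall>i\<in>{1..n}. w i = (\<Sum>k=1..n. c k * b k i)"
    by (rule triangular_lattice_basis[OF diff \<open>M \<noteq> 0\<close> conductor]) auto
  define h where "h = (\<lambda>c. itup (\<lambda>i. \<Sum>k=1..n. Poly_Mapping.lookup c k * b k i))"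
  have mem: "(\<lambda>i. \<Sum>k=1..m. c k * b k i) \<in> W" for c m
  proof (induction m)
    case (Suc m)
    have "(\<lambda>i. c (Suc m) * b (Suc m) i) \<in> W" using scale[OF node_values_const b(1)] .
    from add[OF Suc this] show ?case by simp
  qed (simp add: zero)
  have "h \<in> iso (free_Abelian_group {1..n}) (add_monoid (K\<lparr>carrier := itup ` W\<rparr>))"
    unfolding iso_iff
  proof (intro conjI)
    show "h \<in> hom (free_Abelian_group {1..n}) (add_monoid (K\<lparr>carrier := itup ` W\<rparr>))"
    proof (rule homI)
      show "h x \<in> carrier (add_monoid (K\<lparr>carrier := itup ` W\<rparr>))" for x using mem by (auto simp: h_def)
      show "h (x \<otimes>\<^bsub>free_Abelian_group {1..n}\<^esub> y) = h x \<otimes>\<^bsub>add_monoid (K\<lparr>carrier := itup ` W\<rparr>)\<^esub> h y" for x y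
        by (simp add: h_def itup_def tup_add tup_eq_iff lookup_add distrib_right sum.distrib)
    qed
    show "h ` carrier (free_Abelian_group {1..n}) = carrier (add_monoid (K\<lparr>carrier := itup ` W\<rparr>))"
    proof
      show "h ` carrier (free_Abelian_group {1..n}) \<subseteq> carrier (add_monoid (K\<lparr>carrier := itup ` W\<rparr>))"
        using mem by (auto simp: h_def)
      show "carrier (add_monoid (K\<lparr>carrier := itup ` W\<rparr>)) \<subseteq> h ` carrier (free_Abelian_group {1..n})"
      proof
        fix x assume "x \<in> carrier (add_monoid (K\<lparr>carrier := itup ` W\<rparr>))"
        then obtain w where w: "w \<in> W" "x = itup w" by auto
        obtain c where c: "\<forall>i\<in>{1..n}. w i = (\<Sum>k=1..n. c k * b k i)" using span[OF w(1)] by blast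
        define c' where "c' = Abs_poly_mapping (\<lambda>k. if k \<in> {1..n} then c k else 0)"
        have look: "Poly_Mapping.lookup c' = (\<lambda>k. if k \<in> {1..n} then c k else 0)"
          unfolding c'_def by (rule lookup_Abs_poly_mapping) (rule finite_subset[of _ "{1..n}"], auto)
        have "Poly_Mapping.keys c' \<subseteq> {1..n}" by (auto simp: in_keys_iff look split: if_splits)
        moreover have "x = h c'" unfolding w(2) h_def itup_eq_iff look using c by (auto intro!: sum.cong)
        ultimately show "x \<in> h ` carrier (free_Abelian_group {1..n})" by auto
      qed
    qed
    show "inj_on h (carrier (free_Abelian_group {1..n}))"
    proof (rule inj_onI)
      fix x y assume xy: "x \<in> carrier (free_Abelian_group {1..n})" "y \<in> carrier (free_Abelian_group {1..n})" "h x = h y"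
      have "Poly_Mapping.lookup x k = Poly_Mapping.lookup y k" for k
      proof (cases "k \<in> {1..n}")
        case True
        have "(\<Sum>k=1..n. (Poly_Mapping.lookup x k - Poly_Mapping.lookup y k) * b k i) = 0" if "i \<in> {1..n}" for i
          using xy(3) that by (simp add: h_def itup_eq_iff left_diff_distrib sum_subtractf)
        from triangular_independent[OF b(2,3) this True] show ?thesis by simp
      next
        case False
        then have "k \<notin> Poly_Mapping.keys x" "k \<notin> Poly_Mapping.keys y" using xy(1,2) by auto
        then show ?thesis by (simp add: in_keys_iff)
      qed
      then show "x = y" by (rule poly_mapping_eqI)
    qed
  qed
  then have "add_monoid (K\<lparr>carrier := itup ` W\<rparr>) \<cong> free_Abelian_group {1..n}"
    by (intro group.iso_sym[OF group_free_Abelian_group] is_isoI)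
  then show ?thesis using sub unfolding frac_ideal_def degree_chi by blast
qed

section \<open>The ideals \<open>u R + D \<int>\<^sup>n\<close>\<close>

text \<open>The number \<open>D = \<Delta>\<close>.\<close>
definition modulus :: int where
  "modulus = (\<Prod>j=1..n. newton_step a j)"

lemma newton_step_dvd_modulus: "j \<in> {1..n} \<Longrightarrow> newton_step a j dvd modulus"
  unfolding modulus_def by (rule dvd_prodI) auto

lemma modulus_pos: "modulus > 0"
  unfolding modulus_def using newton_step_pos[OF mono] by (rule prod_pos)

lemma modulus_mult_node_values: "(\<lambda>i. modulus * w i) \<in> node_values n a"
  unfolding modulus_def by (rule node_values_conductor[OF inj_nodes])

lemma node_values_cong_modulus:
  assumes "v \<in> node_values n a" and "\<And>i. i \<in> {1..n} \<Longrightarrow> [w i = v i] (mod modulus)"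
  shows "w \<in> node_values n a"
proof -
  let ?w = "\<lambda>i. v i + modulus * ((w i - v i) div modulus)"
  have "?w \<in> node_values n a" by (rule node_values_add[OF assms(1) modulus_mult_node_values])
  moreover have "w i = ?w i" if "i \<in> {1..n}" for i
    using assms(2)[OF that] by (simp add: cong_iff_dvd_diff)
  then have "w \<in> node_values n a \<longleftrightarrow> ?w \<in> node_values n a" by (rule node_values_cong)
  ultimately show ?thesis by blast
qed

text \<open>By Euler's theorem the inverse of \<open>v\<close> modulo \<open>D\<close> is a power of \<open>v\<close>, and hence again lies in \<open>R\<close>.\<close>
lemma node_values_inverse:
  assumes "v \<in> node_values n a" and cop: "\<And>i. i \<in> {1..n} \<Longrightarrow> coprime (v i) modulus"
  obtains r where "r \<in> node_values n a" "\<And>i. i \<in> {1..n} \<Longrightarrow> [v i * r i = 1] (mod modulus)"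
proof
  let ?t = "totient (nat modulus)"
  show "(\<lambda>i. v i ^ (?t - 1)) \<in> node_values n a" by (rule node_values_power[OF assms(1)])
  have "?t > 0" using modulus_pos by simp
  then have "v i * v i ^ (?t - 1) = v i ^ ?t" for i by (metis power_eq_if gr_implies_not0)
  then show "[v i * v i ^ (?t - 1) = 1] (mod modulus)" if "i \<in> {1..n}" for i
    using euler_theorem_int[OF modulus_pos cop[OF that]] by simp
qed

text \<open>The lattice \<open>u R + D \<int>\<^sup>n\<close> of integer tuples.\<close>
definition lattice_of :: "(nat \<Rightarrow> int) \<Rightarrow> (nat \<Rightarrow> int) set" where
  "lattice_of u = {w. \<exists>r\<in>node_values n a. \<forall>i\<in>{1..n}. [w i = u i * r i] (mod modulus)}"

lemma lattice_ofI:
  "r \<in> node_values n a \<Longrightarrow> (\<And>i. i \<in> {1..n} \<Longrightarrow> [w i = u i * r i] (mod modulus)) \<Longrightarrow> w \<in> lattice_of u"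
  unfolding lattice_of_def by blast

lemma lattice_ofE:
  assumes "w \<in> lattice_of u"
  obtains r where "r \<in> node_values n a" "\<And>i. i \<in> {1..n} \<Longrightarrow> [w i = u i * r i] (mod modulus)"
  using assms unfolding lattice_of_def by blast

lemma lattice_of_cong:
  assumes "\<And>i. i \<in> {1..n} \<Longrightarrow> [u i = v i] (mod modulus)"
  shows "lattice_of u = lattice_of v"
proof -
  have "[w i = u i * r i] (mod modulus) \<longleftrightarrow> [w i = v i * r i] (mod modulus)" if "i \<in> {1..n}" for w r i
    using cong_mult[OF assms[OF that] cong_refl[of "r i"]] by (auto intro: cong_trans cong_sym)
  then show ?thesis unfolding lattice_of_def by (intro Collect_cong bex_cong[OF refl] ball_cong[OF refl])
qed

lemma lattice_of_diff: "v \<in> lattice_of u \<Longrightarrow> w \<in> lattice_of u \<Longrightarrow> (\<lambda>i. v i - w i) \<in> lattice_of u"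
proof (elim lattice_ofE)
  fix r s assume rs: "r \<in> node_values n a" "s \<in> node_values n a"
    and v: "\<And>i. i \<in> {1..n} \<Longrightarrow> [v i = u i * r i] (mod modulus)"
    and w: "\<And>i. i \<in> {1..n} \<Longrightarrow> [w i = u i * s i] (mod modulus)"
  show "(\<lambda>i. v i - w i) \<in> lattice_of u"
    by (rule lattice_ofI[OF node_values_diff[OF rs]])
       (use cong_diff[OF v w] in \<open>simp add: right_diff_distrib\<close>)
qed

lemma lattice_of_mult: "r \<in> node_values n a \<Longrightarrow> w \<in> lattice_of u \<Longrightarrow> (\<lambda>i. r i * w i) \<in> lattice_of u"
proof (elim lattice_ofE)
  fix s assume rs: "r \<in> node_values n a" "s \<in> node_values n a"
    and w: "\<And>i. i \<in> {1..n} \<Longrightarrow> [w i = u i * s i] (mod modulus)"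
  show "(\<lambda>i. r i * w i) \<in> lattice_of u"
    by (rule lattice_ofI[OF node_values_mult[OF rs]])
       (use cong_scalar_left[OF w] in \<open>simp add: mult.left_commute\<close>)
qed

lemma lattice_of_zero_mod:
  assumes "\<And>i. i \<in> {1..n} \<Longrightarrow> [w i = 0] (mod modulus)"
  shows "w \<in> lattice_of u"
  by (rule lattice_ofI[OF node_values_const[of 0]]) (use assms in simp)

definition ideal_of :: "(nat \<Rightarrow> int) \<Rightarrow> rat poly set set" where
  "ideal_of u = itup ` lattice_of u"

lemma frac_ideal_ideal_of: "frac_ideal (chi n a) (ideal_of u)"
  unfolding ideal_of_def
proof (rule frac_ideal_integer_lattice[of _ modulus])
  show "(\<lambda>i. modulus * w i) \<in> lattice_of u" for w by (rule lattice_of_zero_mod) (simp add: cong_def)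
qed (use modulus_pos lattice_of_diff lattice_of_mult in auto)

lemma itup_mult: "itup u \<otimes>\<^bsub>K\<^esub> itup v = itup (\<lambda>i. u i * v i)"
  by (simp add: itup_def tup_mult)

lemma itup_add: "itup u \<oplus>\<^bsub>K\<^esub> itup v = itup (\<lambda>i. u i + v i)"
  by (simp add: itup_def tup_add)

text \<open>The inclusion of the product in \<open>R\<close> is clear modulo \<open>D\<close>. For the converse, \<open>x \<in> R\<close> is written as
  \<open>(u x) v + y\<close> with \<open>y = x (1 - u v) \<in> D \<int>\<^sup>n\<close>, and \<open>y\<close> as \<open>u (v y) + y (1 - u v)\<close>, where now all factors lie
  in the two ideals.\<close>
lemma ideal_of_mult_inverse:
  assumes uv: "\<And>i. i \<in> {1..n} \<Longrightarrow> [u i * v i = 1] (mod modulus)"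
  shows "ideal_of u \<cdot>\<^bsub>K\<^esub> ideal_of v = unit_ideal (chi n a)"
  unfolding unit_ideal_eq
proof (intro equalityI subsetI)
    fix x assume "x \<in> ideal_of u \<cdot>\<^bsub>K\<^esub> ideal_of v"
    then show "x \<in> itup ` node_values n a"
    proof (induction rule: ideal_prod.induct)
      case (prod x y)
      then obtain w z where wz: "w \<in> lattice_of u" "z \<in> lattice_of v" "x = itup w" "y = itup z"
        by (auto simp: ideal_of_def)
      obtain r where r: "r \<in> node_values n a" "\<And>i. i \<in> {1..n} \<Longrightarrow> [w i = u i * r i] (mod modulus)"
        using wz(1) unfolding lattice_of_def by blast
      obtain s where s: "s \<in> node_values n a" "\<And>i. i \<in> {1..n} \<Longrightarrow> [z i = v i * s i] (mod modulus)"
        using wz(2) unfolding lattice_of_def by blast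
      have "(\<lambda>i. w i * z i) \<in> node_values n a"
      proof (rule node_values_cong_modulus[OF node_values_mult[OF r(1) s(1)]])
        fix i assume i: "i \<in> {1..n}"
        have "[w i * z i = (u i * v i) * (r i * s i)] (mod modulus)"
          using cong_mult[OF r(2)[OF i] s(2)[OF i]] by (simp add: mult_ac)
        also have "[(u i * v i) * (r i * s i) = 1 * (r i * s i)] (mod modulus)"
          by (rule cong_scalar_right[OF uv[OF i]])
        finally show "[w i * z i = r i * s i] (mod modulus)" by simp
      qed
      then show ?case by (auto simp: wz(3,4) itup_mult)
    next
      case (sum x y)
      then show ?case using node_values_add by (auto simp: itup_add)
    qed
next
    fix Z assume "Z \<in> itup ` node_values n a"
    then obtain x where x: "x \<in> node_values n a" "Z = itup x" by blast
    have prod: "itup (\<lambda>i. w i * z i) \<in> ideal_of u \<cdot>\<^bsub>K\<^esub> ideal_of v" if "w \<in> lattice_of u" "z \<in> lattice_of v" for w z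
      unfolding itup_mult[symmetric] by (rule ideal_prod.prod) (use that in \<open>auto simp: ideal_of_def\<close>)
    let ?y = "\<lambda>i. x i * (1 - u i * v i)"
    have d: "[1 - u i * v i = 0] (mod modulus)" if "i \<in> {1..n}" for i
      using cong_diff[OF cong_refl[of 1] uv[OF that]] by simp
    have y: "[?y i = 0] (mod modulus)" if "i \<in> {1..n}" for i
      using cong_scalar_left[OF d[OF that], of "x i"] by simp
    have 1: "(\<lambda>i. u i * x i) \<in> lattice_of u" "v \<in> lattice_of v" "u \<in> lattice_of u"
      by (rule lattice_ofI[OF x(1)], simp, (rule lattice_ofI[OF node_values_const[of 1]], simp)+)
    have 2: "(\<lambda>i. v i * ?y i) \<in> lattice_of v"
      by (rule lattice_of_zero_mod) (use cong_scalar_left[OF y] in simp)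
    have 3: "?y \<in> lattice_of u" "(\<lambda>i. 1 - u i * v i) \<in> lattice_of v"
      by (rule lattice_of_zero_mod, use y d in simp)+
    have "Z = itup (\<lambda>i. (u i * x i) * v i + (u i * (v i * ?y i) + ?y i * (1 - u i * v i)))"
      unfolding x(2) itup_eq_iff by (simp add: algebra_simps)
    also have "\<dots> \<in> ideal_of u \<cdot>\<^bsub>K\<^esub> ideal_of v"
      unfolding itup_add[symmetric]
      by (intro ideal_prod.sum prod) (use 1 2 3 in auto)
    finally show "Z \<in> ideal_of u \<cdot>\<^bsub>K\<^esub> ideal_of v" .
qed

lemma invertible_ideal_of:
  assumes "\<And>i. i \<in> {1..n} \<Longrightarrow> coprime (u i) modulus"
  shows "invertible_ideal (chi n a) (ideal_of u)"
proof -
  have "\<forall>i. \<exists>v. i \<in> {1..n} \<longrightarrow> [u i * v = 1] (mod modulus)"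
    using assms cong_solve_coprime_int by blast
  then obtain v where "\<And>i. i \<in> {1..n} \<Longrightarrow> [u i * v i = 1] (mod modulus)" by metis
  then show ?thesis
    unfolding invertible_ideal_def using frac_ideal_ideal_of ideal_of_mult_inverse by blast
qed

lemma frac_ideal_subset: "frac_ideal (chi n a) I \<Longrightarrow> I = tup ` {v. tup v \<in> I}"
  unfolding frac_ideal_def using submodule_tupD(1) by blast

section \<open>Equivalence of the ideals \<open>u R + D \<int>\<^sup>n\<close>\<close>
lemma ideal_equiv_iff:
  "(I, J) \<in> ideal_equiv (chi n a) \<longleftrightarrow> frac_ideal (chi n a) I \<and> frac_ideal (chi n a) J \<and>
     (\<exists>k. (\<forall>i\<in>{1..n}. k i \<noteq> 0) \<and> I = tup k <#\<^bsub>K\<^esub> J)"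
proof -
  have "(\<exists>k\<in>Units K. I = k <#\<^bsub>K\<^esub> J) \<longleftrightarrow> (\<exists>k. tup k \<in> Units K \<and> I = tup k <#\<^bsub>K\<^esub> J)"
    by (auto simp: Units_def carrier_K)
  then show ?thesis by (simp add: ideal_equiv_def Units_K)
qed

lemma l_coset_tup_l_coset:
  assumes "frac_ideal (chi n a) J"
  shows "tup k <#\<^bsub>K\<^esub> (tup l <#\<^bsub>K\<^esub> J) = tup (\<lambda>i. k i * l i) <#\<^bsub>K\<^esub> J"
proof -
  obtain L where "J = tup ` L" using frac_ideal_subset[OF assms] by blast
  then show ?thesis by (auto simp: l_coset_def tup_mult mult.assoc)
qed

lemma l_coset_tup_one:
  assumes "frac_ideal (chi n a) J" and "\<And>i. i \<in> {1..n} \<Longrightarrow> k i = 1"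
  shows "tup k <#\<^bsub>K\<^esub> J = J"
proof -
  have "tup k = tup (\<lambda>_. 1)" using assms(2) by (simp add: tup_eq_iff)
  moreover obtain L where "J = tup ` L" using frac_ideal_subset[OF assms(1)] by blast
  ultimately show ?thesis by (simp add: l_coset_tup)
qed

lemma equiv_ideal_equiv: "equiv {I. frac_ideal (chi n a) I} (ideal_equiv (chi n a))"
proof (rule equivI)
  show "ideal_equiv (chi n a) \<subseteq> {I. frac_ideal (chi n a) I} \<times> {I. frac_ideal (chi n a) I}"
    by (auto simp: ideal_equiv_iff)
  show "refl_on {I. frac_ideal (chi n a) I} (ideal_equiv (chi n a))"
  proof (rule refl_onI)
    fix I assume "I \<in> {I. frac_ideal (chi n a) I}"
    then show "(I, I) \<in> ideal_equiv (chi n a)"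
      unfolding ideal_equiv_iff using l_coset_tup_one[of I "\<lambda>_. 1"]
      by (intro conjI exI[of _ "\<lambda>_. 1"]) auto
  qed
  show "sym (ideal_equiv (chi n a))"
  proof (rule symI)
    fix I J assume "(I, J) \<in> ideal_equiv (chi n a)"
    then obtain k where k: "frac_ideal (chi n a) I" "frac_ideal (chi n a) J" "\<forall>i\<in>{1..n}. k i \<noteq> 0" "I = tup k <#\<^bsub>K\<^esub> J"
      unfolding ideal_equiv_iff by blast
    have "J = tup (\<lambda>i. inverse (k i)) <#\<^bsub>K\<^esub> I"
      unfolding k(4) l_coset_tup_l_coset[OF k(2)] by (rule l_coset_tup_one[symmetric]) (use k(2,3) in auto)
    then show "(J, I) \<in> ideal_equiv (chi n a)"
      unfolding ideal_equiv_iff using k by (auto intro!: exI[of _ "\<lambda>i. inverse (k i)"])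
  qed
  show "trans (ideal_equiv (chi n a))"
  proof (rule transI)
    fix I J L assume "(I, J) \<in> ideal_equiv (chi n a)" "(J, L) \<in> ideal_equiv (chi n a)"
    then obtain k l where k: "frac_ideal (chi n a) I" "frac_ideal (chi n a) L"
      "\<forall>i\<in>{1..n}. k i \<noteq> 0" "I = tup k <#\<^bsub>K\<^esub> J" "\<forall>i\<in>{1..n}. l i \<noteq> 0" "J = tup l <#\<^bsub>K\<^esub> L"
      unfolding ideal_equiv_iff by blast
    have "I = tup (\<lambda>i. k i * l i) <#\<^bsub>K\<^esub> L" unfolding k(4,6) by (rule l_coset_tup_l_coset[OF k(2)])
    then show "(I, L) \<in> ideal_equiv (chi n a)"
      unfolding ideal_equiv_iff using k by (auto intro!: exI[of _ "\<lambda>i. k i * l i"])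
  qed
qed

text \<open>Projected to one coordinate the lattice is all of \<open>\<int>\<close>, by Bezout.\<close>
lemma lattice_of_component_one:
  assumes "coprime (w i) modulus"
  obtains y where "y \<in> lattice_of w" "y i = 1"
proof -
  obtain s t where st: "s * w i + t * modulus = 1"
    using assms(1) bezout_int[of "w i" modulus] by (auto simp: coprime_iff_gcd_eq_1)
  show thesis
  proof (rule that[of "\<lambda>j. w j * s + modulus * t"])
    show "(\<lambda>j. w j * s + modulus * t) \<in> lattice_of w"
      by (rule lattice_ofI[OF node_values_const[of s]]) (simp add: cong_def)
    show "w i * s + modulus * t = 1" using st by (simp add: mult.commute)
  qed
qed

text \<open>If \<open>k\<close> carries one ideal into the other, then it preserves the projection \<open>\<int>\<close> of both ideals to each
  coordinate, so that all its coordinates are signs. Then \<open>u\<close> lies in \<open>k (w R + D \<int>\<^sup>n)\<close>, which is the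
  congruence. Conversely, the congruence can be solved for \<open>w\<close>, since \<open>r\<close> has an inverse in \<open>R\<close> modulo \<open>D\<close>.\<close>
lemma ideal_of_equiv_iff:
  assumes u: "\<And>i. i \<in> {1..n} \<Longrightarrow> coprime (u i) modulus" and w: "\<And>i. i \<in> {1..n} \<Longrightarrow> coprime (w i) modulus"
  shows "(ideal_of u, ideal_of w) \<in> ideal_equiv (chi n a) \<longleftrightarrow>
    (\<exists>e r. r \<in> node_values n a \<and> (\<forall>i\<in>{1..n}. e i \<in> {1, -1} \<and> coprime (r i) modulus \<and>
        [u i = e i * w i * r i] (mod modulus)))" (is "?L \<longleftrightarrow> ?R")
proof
  assume ?L
  then obtain k where k: "ideal_of u = tup k <#\<^bsub>K\<^esub> ideal_of w"
    unfolding ideal_equiv_iff by blast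
  have "\<exists>e. e \<in> {1, -1} \<and> k i = of_int e" if i: "i \<in> {1..n}" for i
  proof -
    obtain y where y: "y \<in> lattice_of w" "y i = 1" using lattice_of_component_one[of w i, OF w[OF i]] .
    have "tup k \<otimes>\<^bsub>K\<^esub> itup y \<in> tup k <#\<^bsub>K\<^esub> ideal_of w"
      using y(1) by (auto simp: l_coset_def ideal_of_def)
    then have "tup k \<otimes>\<^bsub>K\<^esub> itup y \<in> ideal_of u" unfolding k[symmetric] .
    then obtain x where "tup k \<otimes>\<^bsub>K\<^esub> itup y = itup x" by (auto simp: ideal_of_def)
    then have "\<forall>j\<in>{1..n}. k j * of_int (y j) = of_int (x j)" by (simp add: itup_def tup_mult tup_eq_iff)
    from bspec[OF this i] have x: "k i = of_int (x i)" using y(2) by simp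
    obtain z where z: "z \<in> lattice_of u" "z i = 1" using lattice_of_component_one[of u i, OF u[OF i]] .
    have "itup z \<in> tup k <#\<^bsub>K\<^esub> ideal_of w" unfolding k[symmetric] using z(1) by (auto simp: ideal_of_def)
    then obtain y' where "itup z = tup k \<otimes>\<^bsub>K\<^esub> itup y'" by (auto simp: l_coset_def ideal_of_def)
    then have "\<forall>j\<in>{1..n}. of_int (z j) = k j * of_int (y' j)" by (simp add: itup_def tup_mult tup_eq_iff)
    from bspec[OF this i] have "1 = k i * of_int (y' i)" using z(2) by simp
    then have "x i * y' i = 1" unfolding x by (metis of_int_eq_1_iff of_int_mult)
    then show ?thesis using x pos_zmult_eq_1_iff_lemma[of "x i" "y' i"] by blast
  qed
  then obtain e where e: "\<And>i. i \<in> {1..n} \<Longrightarrow> e i \<in> {1, -1} \<and> k i = of_int (e i)" by metis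
  have "u \<in> lattice_of u" by (rule lattice_ofI[OF node_values_const[of 1]]) simp
  then have "itup u \<in> tup k <#\<^bsub>K\<^esub> ideal_of w" unfolding k[symmetric] by (auto simp: ideal_of_def)
  then obtain y where y: "y \<in> lattice_of w" "itup u = tup k \<otimes>\<^bsub>K\<^esub> itup y" by (auto simp: l_coset_def ideal_of_def)
  have uy: "u i = e i * y i" if "i \<in> {1..n}" for i
  proof -
    have "rat_of_int (u i) = rat_of_int (e i * y i)"
      using y(2) that e[OF that] by (simp add: itup_def tup_mult tup_eq_iff)
    then show ?thesis by (simp only: of_int_eq_iff)
  qed
  obtain r where r: "r \<in> node_values n a" "\<And>i. i \<in> {1..n} \<Longrightarrow> [y i = w i * r i] (mod modulus)"
    using y(1) unfolding lattice_of_def by blast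
  have "e i \<in> {1, -1} \<and> coprime (r i) modulus \<and> [u i = e i * w i * r i] (mod modulus)" if i: "i \<in> {1..n}" for i
  proof -
    have c: "[u i = e i * w i * r i] (mod modulus)"
      using cong_scalar_left[OF r(2)[OF i], of "e i"] uy[OF i] by (simp add: mult.assoc)
    then have "coprime (e i * w i * r i) modulus" using u[OF i] cong_imp_coprime by blast
    then show ?thesis using c e[OF i] by simp
  qed
  then show ?R using r(1) by blast
next
  assume ?R
  then obtain e r where r: "r \<in> node_values n a" and e: "\<And>i. i \<in> {1..n} \<Longrightarrow> e i \<in> {1, -1}"
    and cop: "\<And>i. i \<in> {1..n} \<Longrightarrow> coprime (r i) modulus"
    and c: "\<And>i. i \<in> {1..n} \<Longrightarrow> [u i = e i * w i * r i] (mod modulus)" by blast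
  obtain r' where r': "r' \<in> node_values n a" "\<And>i. i \<in> {1..n} \<Longrightarrow> [r i * r' i = 1] (mod modulus)"
    by (rule node_values_inverse[OF r cop]) auto
  have e2: "e i * e i = 1" if "i \<in> {1..n}" for i using e[OF that] by auto
  define k where "k = (\<lambda>i. rat_of_int (e i))"
  have kmult: "tup k \<otimes>\<^bsub>K\<^esub> itup y = itup (\<lambda>i. e i * y i)" for y by (simp add: k_def itup_def tup_mult)
  have "ideal_of u = tup k <#\<^bsub>K\<^esub> ideal_of w"
  proof (intro equalityI subsetI)
      fix Z assume "Z \<in> ideal_of u"
      then obtain x where x: "x \<in> lattice_of u" "Z = itup x" by (auto simp: ideal_of_def)
      obtain s where s: "s \<in> node_values n a" "\<And>i. i \<in> {1..n} \<Longrightarrow> [x i = u i * s i] (mod modulus)"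
        using x(1) unfolding lattice_of_def by blast
      have "(\<lambda>i. e i * x i) \<in> lattice_of w"
      proof (rule lattice_ofI[OF node_values_mult[OF r s(1)]])
        fix i assume i: "i \<in> {1..n}"
        have "[e i * x i = e i * (u i * s i)] (mod modulus)" by (rule cong_scalar_left[OF s(2)[OF i]])
        also have "[e i * (u i * s i) = e i * ((e i * w i * r i) * s i)] (mod modulus)"
          by (intro cong_scalar_left cong_scalar_right c[OF i])
        also have "e i * ((e i * w i * r i) * s i) = (e i * e i) * (w i * (r i * s i))" by (simp add: mult_ac)
        finally show "[e i * x i = w i * (r i * s i)] (mod modulus)" using e2[OF i] by simp
      qed
      moreover have "Z = tup k \<otimes>\<^bsub>K\<^esub> itup (\<lambda>i. e i * x i)"
        unfolding kmult x(2) itup_eq_iff using e2 by (simp add: mult.assoc[symmetric])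
      ultimately show "Z \<in> tup k <#\<^bsub>K\<^esub> ideal_of w" by (auto simp: l_coset_def ideal_of_def)
  next
      fix Z assume "Z \<in> tup k <#\<^bsub>K\<^esub> ideal_of w"
      then obtain y where y: "y \<in> lattice_of w" "Z = itup (\<lambda>i. e i * y i)"
        by (auto simp: l_coset_def ideal_of_def kmult)
      obtain s where s: "s \<in> node_values n a" "\<And>i. i \<in> {1..n} \<Longrightarrow> [y i = w i * s i] (mod modulus)"
        using y(1) unfolding lattice_of_def by blast
      have "(\<lambda>i. e i * y i) \<in> lattice_of u"
      proof (rule lattice_ofI[OF node_values_mult[OF r'(1) s(1)]])
        fix i assume i: "i \<in> {1..n}"
        have "[e i * y i = e i * (w i * s i) * 1] (mod modulus)"
          using cong_scalar_left[OF s(2)[OF i]] by simp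
        also have "[e i * (w i * s i) * 1 = e i * (w i * s i) * (r i * r' i)] (mod modulus)"
          by (rule cong_scalar_left[OF cong_sym[OF r'(2)[OF i]]])
        also have "e i * (w i * s i) * (r i * r' i) = (e i * w i * r i) * (r' i * s i)" by (simp add: mult_ac)
        also have "[(e i * w i * r i) * (r' i * s i) = u i * (r' i * s i)] (mod modulus)"
          by (rule cong_scalar_right[OF cong_sym[OF c[OF i]]])
        finally show "[e i * y i = u i * (r' i * s i)] (mod modulus)" .
      qed
      then show "Z \<in> ideal_of u" by (auto simp: y(2) ideal_of_def)
  qed
  moreover have "\<forall>i\<in>{1..n}. k i \<noteq> 0" using e unfolding k_def by fastforce
  ultimately show ?L unfolding ideal_equiv_iff using frac_ideal_ideal_of by blast
qed

section \<open>Invertible ideals up to equivalence\<close>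
lemma node_values_cong_nodes:
  assumes "r \<in> node_values n a" and "i \<in> {1..n}" "j \<in> {1..n}" and "[a i = a j] (mod p)"
  shows "[r i = r j] (mod p)"
proof -
  obtain g where g: "\<And>i. i \<in> {1..n} \<Longrightarrow> poly g (a i) = r i"
    using assms(1) unfolding node_values_def by blast
  have "a i - a j dvd r i - r j" using poly_diff_dvd[of "a i" "a j" g] g assms(2,3) by simp
  then show ?thesis using assms(4) unfolding cong_iff_dvd_diff by (rule dvd_trans[rotated])
qed

text \<open>Elements of \<open>R\<close> that separate its maximal ideals over a finite set \<open>P\<close> of primes; these ideals correspond to
  pairs of a prime \<open>p \<in> P\<close> and a residue class \<open>c\<close> modulo \<open>p\<close> of some node. The polynomial
  \<open>m\<^sup>t (1 - (x - c)\<^sup>t)\<close> with \<open>t = \<phi>(p)\<close> and \<open>m\<close> the product of the other primes does this, by Fermat's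
  little theorem.\<close>
lemma modulus_separator:
  assumes P: "finite P" "\<And>q. q \<in> P \<Longrightarrow> prime q" and p: "p \<in> P"
  obtains e where "e \<in> node_values n a"
    and "\<And>i. [a i = c] (mod p) \<Longrightarrow> [e i = 1] (mod p)"
    and "\<And>i. \<not> [a i = c] (mod p) \<Longrightarrow> [e i = 0] (mod p)"
    and "\<And>i q. q \<in> P \<Longrightarrow> q \<noteq> p \<Longrightarrow> [e i = 0] (mod (q::int))"
proof -
  define m where "m = \<Prod>(P - {p})"
  let ?t = "totient (nat p)"
  have "prime p" by (rule P(2)[OF p])
  then have "p > 0" by (rule prime_gt_0_int)
  have t: "?t > 0" using \<open>p > 0\<close> by simp
  have "\<not> p dvd m"
  proof
    assume "p dvd m"
    then obtain q where "q \<in> P - {p}" "p dvd q"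
      unfolding m_def using prime_dvd_prod_iff[of "P - {p}" p "\<lambda>x. x"] P(1) \<open>prime p\<close> by auto
    then show False using primes_dvd_imp_eq[of p q] P(2) p by auto
  qed
  then have m1: "[m ^ ?t = 1] (mod p)"
    using euler_theorem_int[OF \<open>p > 0\<close>] prime_imp_coprime[OF \<open>prime p\<close>] by (simp add: coprime_commute)
  define e where "e = (\<lambda>i. m ^ ?t * (1 - (a i - c) ^ ?t))"
  show thesis
  proof (rule that[of e])
    have "e = (\<lambda>i. poly ([:m ^ ?t:] * (1 - [:- c, 1:] ^ ?t)) (a i))"
      by (simp add: e_def fun_eq_iff poly_power)
    then show "e \<in> node_values n a" using node_values_poly by metis
    show "[e i = 1] (mod p)" if "[a i = c] (mod p)" for i
    proof -
      have "p dvd a i - c" using that by (simp add: cong_iff_dvd_diff)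
      then have "p dvd (a i - c) ^ ?t" by (rule dvd_trans) (use t in \<open>simp add: dvd_power\<close>)
      then have "[1 - (a i - c) ^ ?t = 1] (mod p)" by (simp add: cong_iff_dvd_diff)
      from cong_mult[OF m1 this] show ?thesis by (simp add: e_def)
    qed
    show "[e i = 0] (mod p)" if "\<not> [a i = c] (mod p)" for i
    proof -
      have "\<not> p dvd a i - c" using that by (simp add: cong_iff_dvd_diff)
      then have "coprime (a i - c) p" using prime_imp_coprime[OF \<open>prime p\<close>] coprime_commute by blast
      then have "[(a i - c) ^ ?t = 1] (mod p)" by (rule euler_theorem_int[OF \<open>p > 0\<close>])
      from cong_diff[OF cong_refl[of 1] this] have "[1 - (a i - c) ^ ?t = 0] (mod p)" by simp
      from cong_scalar_left[OF this] show ?thesis by (simp add: e_def)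
    qed
    show "[e i = 0] (mod q)" if "q \<in> P" "q \<noteq> p" for i q
    proof -
      have "q dvd m" unfolding m_def using dvd_prodI[of "P - {p}" q "\<lambda>x. x"] P(1) that by simp
      then have "q dvd m ^ ?t" using t by (simp add: dvd_power dvd_trans)
      then show ?thesis by (simp add: e_def cong_0_iff)
    qed
  qed
qed

text \<open>The separating elements glue the local solutions \<open>w\<close> into \<open>u = \<Sum> e w\<close>. Modulo a prime \<open>q\<close> and in coordinate
  \<open>i\<close>, only the summand for the pair \<open>(q, a\<^sub>i mod q)\<close> survives, and it is a unit there.\<close>
lemma lattice_unit_element:
  assumes zero: "(\<lambda>_. 0) \<in> W" and add: "\<And>v w. v \<in> W \<Longrightarrow> w \<in> W \<Longrightarrow> (\<lambda>i. v i + w i) \<in> W"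
    and scale: "\<And>r w. r \<in> node_values n a \<Longrightarrow> w \<in> W \<Longrightarrow> (\<lambda>i. r i * w i) \<in> W"
    and local: "\<And>p i. prime p \<Longrightarrow> i \<in> {1..n} \<Longrightarrow>
      \<exists>w\<in>W. \<forall>j\<in>{1..n}. [a j = a i] (mod p) \<longrightarrow> \<not> p dvd w j"
  obtains u where "u \<in> W" "\<And>i. i \<in> {1..n} \<Longrightarrow> coprime (u i) modulus"
proof -
  define P where "P = prime_factors modulus"
  define T where "T = Sigma P (\<lambda>p. {0..<p})"
  have P: "finite P" "\<And>q. q \<in> P \<Longrightarrow> prime q" by (auto simp: P_def)
  have "finite T" using P(1) by (auto simp: T_def)
  define sep where "sep = (\<lambda>x e. e \<in> node_values n a \<and>
      (\<forall>i. [a i = snd x] (mod fst x) \<longrightarrow> [e i = 1] (mod fst x)) \<and>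
      (\<forall>i. \<not> [a i = snd x] (mod fst x) \<longrightarrow> [e i = 0] (mod fst x)) \<and>
      (\<forall>i. \<forall>q\<in>P. q \<noteq> fst x \<longrightarrow> [e i = 0] (mod q)))"
  have "\<forall>x\<in>T. \<exists>e. sep x e"
  proof
    fix x assume "x \<in> T"
    then have "fst x \<in> P" by (auto simp: T_def)
    show "\<exists>e. sep x e"
      unfolding sep_def by (rule modulus_separator[OF P \<open>fst x \<in> P\<close>, where c = "snd x"]) blast+
  qed
  then obtain e where "\<forall>x\<in>T. sep x (e x)" using bchoice by metis
  then have e: "\<And>x. x \<in> T \<Longrightarrow> e x \<in> node_values n a"
    "\<And>x i. x \<in> T \<Longrightarrow> [a i = snd x] (mod fst x) \<Longrightarrow> [e x i = 1] (mod fst x)"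
    "\<And>x i. x \<in> T \<Longrightarrow> \<not> [a i = snd x] (mod fst x) \<Longrightarrow> [e x i = 0] (mod fst x)"
    "\<And>x i q. x \<in> T \<Longrightarrow> q \<in> P \<Longrightarrow> q \<noteq> fst x \<Longrightarrow> [e x i = 0] (mod q)"
    unfolding sep_def by blast+
  have "\<exists>w. w \<in> W \<and> (\<forall>j\<in>{1..n}. [a j = snd x] (mod fst x) \<longrightarrow> \<not> fst x dvd w j)" if x: "x \<in> T" for x
  proof (cases "\<exists>i\<in>{1..n}. [a i = snd x] (mod fst x)")
    case True
    then obtain i where i: "i \<in> {1..n}" "[a i = snd x] (mod fst x)" by blast
    have "prime (fst x)" using x P(2) by (auto simp: T_def)
    from local[OF this i(1)] obtain w where w: "w \<in> W"
      "\<forall>j\<in>{1..n}. [a j = a i] (mod fst x) \<longrightarrow> \<not> fst x dvd w j" by blast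
    then show ?thesis using cong_trans[OF _ cong_sym[OF i(2)]] by blast
  next
    case False
    then show ?thesis using zero by blast
  qed
  then obtain w where w: "\<And>x. x \<in> T \<Longrightarrow> w x \<in> W"
    "\<And>x j. x \<in> T \<Longrightarrow> j \<in> {1..n} \<Longrightarrow> [a j = snd x] (mod fst x) \<Longrightarrow> \<not> fst x dvd w x j"
    by metis
  define u where "u = (\<lambda>i. \<Sum>x\<in>T. e x i * w x i)"
  have "(\<lambda>i. \<Sum>x\<in>S. e x i * w x i) \<in> W" if "S \<subseteq> T" for S
    using finite_subset[OF that \<open>finite T\<close>] that
  proof (induction S rule: finite_induct)
    case (insert x S)
    then have "(\<lambda>i. e x i * w x i) \<in> W" "(\<lambda>i. \<Sum>x\<in>S. e x i * w x i) \<in> W"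
      using e(1) w(1) scale by simp_all
    from add[OF this] show ?case using insert.hyps by simp
  qed (simp add: zero)
  then have "u \<in> W" by (simp add: u_def)
  moreover have "coprime (u i) modulus" if i: "i \<in> {1..n}" for i
  proof (rule ccontr)
    assume "\<not> coprime (u i) modulus"
    then obtain q where q: "prime q" "q dvd u i" "q dvd modulus"
      using common_prime_divisor modulus_pos by (metis less_irrefl)
    have "q \<in> P" unfolding P_def using q modulus_pos by (simp add: in_prime_factors_iff)
    define x where "x = (q, a i mod q)"
    have "q > 0" by (rule prime_gt_0_int[OF q(1)])
    have x: "x \<in> T" using \<open>q \<in> P\<close> \<open>q > 0\<close> by (simp add: x_def T_def)
    have "q dvd e y i * w y i" if y: "y \<in> T - {x}" for y
    proof -
      have "[e y i = 0] (mod q)"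
      proof (cases "fst y = q")
        case True
        then have "snd y \<noteq> a i mod q" "snd y mod q = snd y" using y by (auto simp: x_def T_def)
        then have "\<not> [a i = snd y] (mod fst y)" using True by (simp add: cong_def)
        then show ?thesis using e(3)[of y i] y True by simp
      next
        case False
        then show ?thesis using e(4)[of y q i] y \<open>q \<in> P\<close> by auto
      qed
      then show ?thesis by (simp add: cong_0_iff)
    qed
    then have "q dvd (\<Sum>y\<in>T - {x}. e y i * w y i)" by (rule dvd_sum)
    moreover have "u i = e x i * w x i + (\<Sum>y\<in>T - {x}. e y i * w y i)"
      unfolding u_def by (rule sum.remove[OF \<open>finite T\<close> x])
    ultimately have "q dvd e x i * w x i" using q(2) by (simp add: dvd_add_left_iff)
    moreover have ai: "[a i = snd x] (mod fst x)" by (simp add: x_def cong_def)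
    then have "[e x i = 1] (mod q)" using e(2)[OF x ai] by (simp add: x_def)
    then have "\<not> q dvd e x i" using q(1) by (metis cong_dvd_iff not_prime_unit)
    moreover have "\<not> q dvd w x i" using w(2)[OF x i ai] by (simp add: x_def)
    ultimately show False using q(1) by (simp add: prime_dvd_mult_iff)
  qed
  ultimately show thesis using that by blast
qed

lemma ideal_prod_tup_sum:
  assumes "z \<in> I \<cdot>\<^bsub>K\<^esub> J" "I \<subseteq> range tup" "J \<subseteq> range tup"
  shows "\<exists>ps. (\<forall>(x, y)\<in>set ps. tup x \<in> I \<and> tup y \<in> J) \<and> z = tup (\<lambda>i. \<Sum>(x, y)\<leftarrow>ps. x i * y i)"
  using assms(1)
proof (induction rule: ideal_prod.induct)
  case (prod s t)
  then obtain x y where "s = tup x" "t = tup y" using assms(2,3) by blast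
  then show ?case using prod by (intro exI[of _ "[(x, y)]"]) (simp add: tup_mult)
next
  case (sum s t)
  then obtain ps qs where "\<forall>(x, y)\<in>set ps. tup x \<in> I \<and> tup y \<in> J" "s = tup (\<lambda>i. \<Sum>(x, y)\<leftarrow>ps. x i * y i)"
    "\<forall>(x, y)\<in>set qs. tup x \<in> I \<and> tup y \<in> J" "t = tup (\<lambda>i. \<Sum>(x, y)\<leftarrow>qs. x i * y i)" by blast
  then show ?case by (intro exI[of _ "ps @ qs"]) (auto simp: tup_add)
qed

lemma sum_list_not_dvd:
  fixes p :: int
  assumes "\<not> p dvd sum_list (map f xs)"
  shows "\<exists>x\<in>set xs. \<not> p dvd f x"
  proof (rule ccontr)
  assume "\<not> (\<exists>x\<in>set xs. \<not> p dvd f x)"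
  then have "p dvd sum_list (map f xs)" by (induction xs) auto
  then show False using assms by blast
qed

text \<open>Let \<open>I J = R\<close>. Since \<open>1\<close> is a sum of products \<open>x y\<close> with \<open>x \<in> I\<close> and \<open>y \<in> J\<close>, for each maximal ideal of \<open>R\<close>
  some product \<open>x y\<close> avoids it. The projection of \<open>I\<close> to the \<open>i\<close>-th coordinate is cyclic, generated by some
  \<open>c\<^sub>i \<noteq> 0\<close>, because multiplication with the \<open>i\<close>-th coordinate of a fixed \<open>y \<in> J\<close> makes it integral. Dividing \<open>I\<close>
  by \<open>c\<close> and multiplying \<open>J\<close> by \<open>c\<close> gives lattices \<open>W\<close> and \<open>V\<close> of integer tuples with \<open>W V = R\<close>. Gluing yields
  \<open>u \<in> W\<close> and \<open>v \<in> V\<close> with all coordinates prime to \<open>D\<close>. If \<open>s \<in> R\<close> inverts \<open>u v\<close> modulo \<open>D\<close>, every \<open>w \<in> W\<close> is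
  congruent to \<open>u (w v s)\<close>, and \<open>w v s \<in> R\<close>; so \<open>W \<subseteq> u R + D \<int>\<^sup>n\<close>. The other inclusion needs \<open>D \<int>\<^sup>n \<subseteq> W\<close>, which
  holds because \<open>D e\<^sub>i \<in> R\<close> for the unit vectors \<open>e\<^sub>i\<close> and \<open>W\<close> contains a tuple with \<open>i\<close>-th coordinate 1.\<close>
lemma invertible_equiv_ideal_of:
  assumes "invertible_ideal (chi n a) I"
  obtains u where "\<And>i. i \<in> {1..n} \<Longrightarrow> coprime (u i) modulus" "(I, ideal_of u) \<in> ideal_equiv (chi n a)"
proof -
  from assms obtain J where I: "frac_ideal (chi n a) I" and J: "frac_ideal (chi n a) J"
    and IJ: "I \<cdot>\<^bsub>K\<^esub> J = itup ` node_values n a"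
    unfolding invertible_ideal_def unit_ideal_eq by blast
  define L where "L = {v. tup v \<in> I}"
  define L' where "L' = {v. tup v \<in> J}"
  have IL: "I = tup ` L" "J = tup ` L'"
    using frac_ideal_subset[OF I] frac_ideal_subset[OF J] by (simp_all add: L_def L'_def)
  note subI = submodule_tupD[OF I[unfolded frac_ideal_def, THEN conjunct1]]
  note subJ = submodule_tupD[OF J[unfolded frac_ideal_def, THEN conjunct1]]
  have L0: "(\<lambda>_. 0) \<in> L" using subI(2) by (simp add: L_def)
  have L_add: "(\<lambda>i. u i + v i) \<in> L" if "u \<in> L" "v \<in> L" for u v using subI(3) that by (simp add: L_def)
  have L_mult: "(\<lambda>i. of_int (r i) * v i) \<in> L" if "r \<in> node_values n a" "v \<in> L" for r v
    using subI(4) that by (simp add: L_def)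
  have L_cong: "v \<in> L" if "u \<in> L" "\<And>i. i \<in> {1..n} \<Longrightarrow> u i = v i" for u v
    using that tup_eq_iff[of u v] by (simp add: L_def)
  have L'0: "(\<lambda>_. 0) \<in> L'" using subJ(2) by (simp add: L'_def)
  have L'_add: "(\<lambda>i. u i + v i) \<in> L'" if "u \<in> L'" "v \<in> L'" for u v using subJ(3) that by (simp add: L'_def)
  have L'_mult: "(\<lambda>i. of_int (r i) * v i) \<in> L'" if "r \<in> node_values n a" "v \<in> L'" for r v
    using subJ(4) that by (simp add: L'_def)
  have L'_cong: "v \<in> L'" if "u \<in> L'" "\<And>i. i \<in> {1..n} \<Longrightarrow> u i = v i" for u v
    using that tup_eq_iff[of u v] by (simp add: L'_def)
  have prod: "\<exists>r\<in>node_values n a. \<forall>i\<in>{1..n}. x i * y i = of_int (r i)" if "x \<in> L" "y \<in> L'" for x y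
  proof -
    have "tup x \<otimes>\<^bsub>K\<^esub> tup y \<in> I \<cdot>\<^bsub>K\<^esub> J" using that by (intro ideal_prod.prod) (simp_all add: L_def L'_def)
    then obtain r where "r \<in> node_values n a" "tup x \<otimes>\<^bsub>K\<^esub> tup y = itup r" unfolding IJ by blast
    then show ?thesis by (intro bexI[of _ r]) (simp_all add: tup_mult itup_def tup_eq_iff)
  qed
  have loc: "\<exists>x\<in>L. \<exists>y\<in>L'. \<exists>r\<in>node_values n a. (\<forall>j\<in>{1..n}. x j * y j = of_int (r j)) \<and> \<not> p dvd r i"
    if p: "prime p" and i: "i \<in> {1..n}" for p i
  proof -
    have "itup (\<lambda>_. 1) \<in> I \<cdot>\<^bsub>K\<^esub> J" unfolding IJ using node_values_const[of 1] by blast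
    moreover have "I \<subseteq> range tup" "J \<subseteq> range tup" by (subst IL, blast)+
    ultimately obtain ps where ps: "\<And>x y. (x, y) \<in> set ps \<Longrightarrow> x \<in> L \<and> y \<in> L'"
      "itup (\<lambda>_. 1) = tup (\<lambda>i. \<Sum>(x, y)\<leftarrow>ps. x i * y i)"
      using ideal_prod_tup_sum[of "itup (\<lambda>_. 1)" I J] by (fastforce simp: L_def L'_def)
    have one: "(\<Sum>(x, y)\<leftarrow>ps. x i * y i) = 1"
      using ps(2) i by (simp add: itup_def tup_eq_iff)
    have "\<exists>r. r \<in> node_values n a \<and> (\<forall>j\<in>{1..n}. fst z j * snd z j = of_int (r j))" if "z \<in> set ps" for z
      using prod[of "fst z" "snd z"] ps(1)[of "fst z" "snd z"] that by auto
    then obtain r where r: "\<And>z. z \<in> set ps \<Longrightarrow> r z \<in> node_values n a"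
      "\<And>z j. z \<in> set ps \<Longrightarrow> j \<in> {1..n} \<Longrightarrow> fst z j * snd z j = of_int (r z j)" by metis
    have "rat_of_int (\<Sum>z\<leftarrow>ps. r z i) = (\<Sum>z\<leftarrow>ps. of_int (r z i))" by (induction ps) auto
    also have "\<dots> = (\<Sum>(x, y)\<leftarrow>ps. x i * y i)"
      using r(2)[OF _ i] by (intro arg_cong[of _ _ sum_list] map_cong refl) (simp add: case_prod_unfold)
    finally have "(\<Sum>z\<leftarrow>ps. r z i) = 1" unfolding one by (simp only: of_int_eq_1_iff)
    then have "\<not> p dvd (\<Sum>z\<leftarrow>ps. r z i)" using p not_prime_unit by auto
    then obtain z where z: "z \<in> set ps" "\<not> p dvd r z i" using sum_list_not_dvd by blast
    show ?thesis
      using ps(1)[of "fst z" "snd z"] r(1)[OF z(1)] r(2)[OF z(1)] z by (metis prod.collapse)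
  qed
  define gen where "gen = (\<lambda>i c. c \<noteq> 0 \<and> (\<exists>x\<in>L. x i = c) \<and> (\<forall>x\<in>L. \<exists>z. x i = c * of_int z))"
  have "\<forall>i\<in>{1..n}. \<exists>c. gen i c"
  proof
    fix i assume i: "i \<in> {1..n}"
    \<comment> \<open>Being odd is a convenient way to be nonzero: any prime would do.\<close>
    obtain x0 y r where xy: "x0 \<in> L" "y \<in> L'" "x0 i * y i = of_int (r i)" "\<not> 2 dvd r i"
      using loc[OF two_is_prime i] i by blast
    have y0: "y i \<noteq> 0" using xy(3,4) by auto
    define S where "S = {z. \<exists>x\<in>L. x i * y i = of_int z}"
    have "r i \<in> S" "r i \<noteq> 0" using xy by (auto simp: S_def)
    moreover have "s - t \<in> S" if st: "s \<in> S" "t \<in> S" for s t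
    proof -
      obtain x x' where "x \<in> L" "x' \<in> L" "x i * y i = of_int s" "x' i * y i = of_int t"
        using st unfolding S_def by blast
      then show ?thesis unfolding S_def
        using L_add[OF _ L_mult[OF node_values_const[of "-1"]], of x x']
        by (auto intro!: bexI[of _ "\<lambda>i. x i + of_int (- 1) * x' i"] simp: algebra_simps)
    qed
    ultimately obtain d where d: "d \<in> S" "d > 0" "\<And>z. z \<in> S \<Longrightarrow> d dvd z"
      using int_subgroup_generator by metis
    show "\<exists>c. gen i c"
      unfolding gen_def
    proof (intro exI[of _ "of_int d / y i"] conjI ballI)
      show "of_int d / y i \<noteq> 0" using d(2) y0 by simp
      show "\<exists>x\<in>L. x i = of_int d / y i" using d(1) y0 by (auto simp: S_def field_simps)
      fix x assume x: "x \<in> L"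
      obtain s where s: "x i * y i = of_int (s i)" using prod[OF x xy(2)] i by blast
      then have "d dvd s i" using x by (intro d(3)) (auto simp: S_def)
      then obtain z where "s i = d * z" by (elim dvdE)
      then show "\<exists>z. x i = of_int d / y i * of_int z"
        using s y0 by (intro exI[of _ z]) (simp add: field_simps)
    qed
  qed
  then obtain c where "\<forall>i\<in>{1..n}. gen i (c i)" using bchoice by metis
  then have c: "\<And>i. i \<in> {1..n} \<Longrightarrow> c i \<noteq> 0" "\<And>i. i \<in> {1..n} \<Longrightarrow> \<exists>x\<in>L. x i = c i"
    "\<And>i x. i \<in> {1..n} \<Longrightarrow> x \<in> L \<Longrightarrow> \<exists>z. x i = c i * of_int z"
    unfolding gen_def by blast+
  define W where "W = {w. (\<lambda>i. c i * of_int (w i)) \<in> L}"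
  define V where "V = {v. (\<lambda>i. of_int (v i) / c i) \<in> L'}"
  \<comment> \<open>Since \<open>L\<close> does not see coordinates outside \<open>{1..n}\<close>, all its elements come from \<open>W\<close> up to such coordinates.\<close>
  have fromL: "\<exists>w\<in>W. \<forall>i\<in>{1..n}. x i = c i * of_int (w i)" if x: "x \<in> L" for x
  proof -
    obtain w where w: "\<And>i. i \<in> {1..n} \<Longrightarrow> x i = c i * of_int (w i)" using c(3)[OF _ x] by metis
    have "(\<lambda>i. c i * of_int (w i)) \<in> L" by (rule L_cong[OF x]) (rule w)
    then have "w \<in> W" by (simp add: W_def)
    then show ?thesis using w by blast
  qed
  have fromL': "\<exists>v\<in>V. \<forall>i\<in>{1..n}. y i = of_int (v i) / c i" if y: "y \<in> L'" for y
  proof -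
    have "\<exists>z. y i = of_int z / c i" if i: "i \<in> {1..n}" for i
    proof -
      obtain x where x: "x \<in> L" "x i = c i" using c(2)[OF i] by blast
      obtain r where "c i * y i = of_int (r i)" using prod[OF x(1) y] i x(2) by metis
      then show ?thesis using c(1)[OF i] by (intro exI[of _ "r i"]) (simp add: field_simps)
    qed
    then obtain v where v: "\<And>i. i \<in> {1..n} \<Longrightarrow> y i = of_int (v i) / c i" by metis
    have "(\<lambda>i. of_int (v i) / c i) \<in> L'" by (rule L'_cong[OF y]) (rule v)
    then have "v \<in> V" by (simp add: V_def)
    then show ?thesis using v by blast
  qed
  have W0: "(\<lambda>_. 0) \<in> W" "(\<lambda>_. 0) \<in> V" using L0 L'0 by (simp_all add: W_def V_def)
  have W_add: "(\<lambda>i. v i + w i) \<in> W" if "v \<in> W" "w \<in> W" for v w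
    using L_add that by (simp add: W_def distrib_left)
  have V_add: "(\<lambda>i. v i + w i) \<in> V" if "v \<in> V" "w \<in> V" for v w
    using L'_add that by (simp add: V_def add_divide_distrib)
  have W_mult: "(\<lambda>i. r i * w i) \<in> W" if "r \<in> node_values n a" "w \<in> W" for r w
    using L_mult[of r "\<lambda>i. c i * of_int (w i)"] that by (simp add: W_def mult.left_commute)
  have V_mult: "(\<lambda>i. r i * w i) \<in> V" if "r \<in> node_values n a" "w \<in> V" for r w
    using L'_mult[of r "\<lambda>i. of_int (w i) / c i"] that by (simp add: V_def)
  have W_cong: "w \<in> W" if "v \<in> W" "\<And>i. i \<in> {1..n} \<Longrightarrow> v i = w i" for v w
    using that L_cong[of "\<lambda>i. c i * of_int (v i)" "\<lambda>i. c i * of_int (w i)"] by (simp add: W_def)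
  have WV: "(\<lambda>i. w i * v i) \<in> node_values n a" if wv: "w \<in> W" "v \<in> V" for w v
  proof -
    obtain r where r: "r \<in> node_values n a" "\<forall>i\<in>{1..n}. c i * of_int (w i) * (of_int (v i) / c i) = of_int (r i)"
      using prod[of "\<lambda>i. c i * of_int (w i)" "\<lambda>i. of_int (v i) / c i"] wv unfolding W_def V_def by blast
    have "w i * v i = r i" if i: "i \<in> {1..n}" for i
    proof -
      have "rat_of_int (w i * v i) = of_int (r i)" using bspec[OF r(2) i] c(1)[OF i] by (simp add: field_simps)
      then show ?thesis by (simp only: of_int_eq_iff)
    qed
    then show ?thesis using r(1) by (subst node_values_cong[of _ _ r]) auto
  qed
  have one_W: "\<exists>w\<in>W. w i = 1" if i: "i \<in> {1..n}" for i
  proof -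
    obtain x where x: "x \<in> L" "x i = c i" using c(2)[OF i] by blast
    obtain w where "w \<in> W" "x i = c i * of_int (w i)" using fromL[OF x(1)] i by blast
    then show ?thesis using x(2) c(1)[OF i] by (intro bexI[of _ w]) simp_all
  qed
  have locW: "\<exists>w\<in>W. \<exists>v\<in>V. \<forall>j\<in>{1..n}. [a j = a i] (mod p) \<longrightarrow> \<not> p dvd w j * v j"
    if p: "prime p" and i: "i \<in> {1..n}" for p i
  proof -
    obtain x y r where xyr: "x \<in> L" "y \<in> L'" "\<forall>j\<in>{1..n}. x j * y j = of_int (r j)"
      "r \<in> node_values n a" "\<not> p dvd r i" using loc[OF p i] by blast
    obtain w where w: "w \<in> W" "\<forall>j\<in>{1..n}. x j = c j * of_int (w j)" using fromL[OF xyr(1)] by blast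
    obtain v where v: "v \<in> V" "\<forall>j\<in>{1..n}. y j = of_int (v j) / c j" using fromL'[OF xyr(2)] by blast
    have "w j * v j = r j" if j: "j \<in> {1..n}" for j
    proof -
      have "rat_of_int (w j * v j) = of_int (r j)"
        using bspec[OF w(2) j] bspec[OF v(2) j] bspec[OF xyr(3) j] c(1)[OF j] by simp
      then show ?thesis by (simp only: of_int_eq_iff)
    qed
    moreover have "\<not> p dvd r j" if "j \<in> {1..n}" "[a j = a i] (mod p)" for j
      using node_values_cong_nodes[OF xyr(4) that(1) i that(2)] xyr(5) cong_dvd_iff by blast
    ultimately show ?thesis using w(1) v(1) by (intro bexI[of _ w] bexI[of _ v]) auto
  qed
  obtain u where u: "u \<in> W" "\<And>i. i \<in> {1..n} \<Longrightarrow> coprime (u i) modulus"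
  proof (rule lattice_unit_element[OF W0(1) W_add W_mult])
    show "\<exists>w\<in>W. \<forall>j\<in>{1..n}. [a j = a i] (mod p) \<longrightarrow> \<not> p dvd w j" if "prime p" "i \<in> {1..n}" for p i
      using locW[OF that] by (meson dvd_mult2)
  qed auto
  obtain v where v: "v \<in> V" "\<And>i. i \<in> {1..n} \<Longrightarrow> coprime (v i) modulus"
  proof (rule lattice_unit_element[OF W0(2) V_add V_mult])
    show "\<exists>w\<in>V. \<forall>j\<in>{1..n}. [a j = a i] (mod p) \<longrightarrow> \<not> p dvd w j" if "prime p" "i \<in> {1..n}" for p i
      using locW[OF that] by (meson dvd_mult)
  qed auto
  obtain s where s: "s \<in> node_values n a" "\<And>i. i \<in> {1..n} \<Longrightarrow> [u i * v i * s i = 1] (mod modulus)"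
    by (rule node_values_inverse[OF WV[OF u(1) v(1)]]) (use u(2) v(2) in auto)
  have "W \<subseteq> lattice_of u"
  proof
    fix w assume w: "w \<in> W"
    show "w \<in> lattice_of u"
    proof (rule lattice_ofI[OF node_values_mult[OF WV[OF w v(1)] s(1)]])
      fix i assume i: "i \<in> {1..n}"
      show "[w i = u i * (w i * v i * s i)] (mod modulus)"
        using cong_scalar_left[OF cong_sym[OF s(2)[OF i]], of "w i"] by (simp add: mult_ac)
    qed
  qed
  moreover have "lattice_of u \<subseteq> W"
  proof
    fix w assume "w \<in> lattice_of u"
    then obtain r where r: "r \<in> node_values n a" "\<And>i. i \<in> {1..n} \<Longrightarrow> [w i = u i * r i] (mod modulus)"
      unfolding lattice_of_def by blast
    obtain k where k: "\<And>i. i \<in> {1..n} \<Longrightarrow> w i - u i * r i = modulus * k i"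
      using r(2) unfolding cong_iff_dvd_diff dvd_def by metis
    obtain b where b: "\<And>i. i \<in> {1..n} \<Longrightarrow> b i \<in> W \<and> b i i = 1" using one_W by metis
    have "(\<lambda>j. \<Sum>i=1..m. (modulus * (if j = i then k i else 0)) * b i j) \<in> W" if "m \<le> n" for m
      using that
    proof (induction m)
      case (Suc m)
      have "(\<lambda>j. (modulus * (if j = Suc m then k (Suc m) else 0)) * b (Suc m) j) \<in> W"
        using b[of "Suc m"] Suc.prems by (intro W_mult modulus_mult_node_values) auto
      from W_add[OF Suc.IH this] show ?case using Suc.prems by simp
    qed (simp add: W0)
    from W_add[OF W_mult[OF r(1) u(1)] this[OF order_refl]]
    show "w \<in> W"
    proof (rule W_cong)
      fix j assume j: "j \<in> {1..n}"
      have "(\<Sum>i=1..n. (modulus * (if j = i then k i else 0)) * b i j) = (\<Sum>i=1..n. if j = i then modulus * k i else 0)"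
        by (rule sum.cong) (use b in auto)
      also have "\<dots> = modulus * k j" using j by simp
      finally show "r j * u j + (\<Sum>i=1..n. (modulus * (if j = i then k i else 0)) * b i j) = w j"
        using k[OF j] by (simp add: algebra_simps)
    qed
  qed
  ultimately have "W = lattice_of u" by blast
  have "I = tup c <#\<^bsub>K\<^esub> ideal_of u"
  proof (intro equalityI subsetI)
    fix z assume "z \<in> I"
    then obtain x where x: "x \<in> L" "z = tup x" unfolding IL(1) by blast
    obtain w where w: "w \<in> W" "\<forall>i\<in>{1..n}. x i = c i * of_int (w i)" using fromL[OF x(1)] by blast
    then have "z = tup c \<otimes>\<^bsub>K\<^esub> itup w" by (simp add: x(2) itup_def tup_mult tup_eq_iff)
    then show "z \<in> tup c <#\<^bsub>K\<^esub> ideal_of u" using w(1) \<open>W = lattice_of u\<close> by (auto simp: l_coset_def ideal_of_def)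
  next
    fix z assume "z \<in> tup c <#\<^bsub>K\<^esub> ideal_of u"
    then obtain w where "w \<in> W" "z = tup c \<otimes>\<^bsub>K\<^esub> itup w"
      using \<open>W = lattice_of u\<close> by (auto simp: l_coset_def ideal_of_def)
    then show "z \<in> I" by (simp add: W_def L_def itup_def tup_mult)
  qed
  then have "(I, ideal_of u) \<in> ideal_equiv (chi n a)"
    unfolding ideal_equiv_iff using I frac_ideal_ideal_of c(1) by blast
  then show thesis using that u(2) by blast
qed

section \<open>The class number\<close>

text \<open>Representatives of the unit group of \<open>\<int>\<^sup>n / D \<int>\<^sup>n\<close>, made unique by extensionality.\<close>
definition unit_tuples :: "(nat \<Rightarrow> int) set" where
  "unit_tuples = {1..n} \<rightarrow>\<^sub>E unit_residues modulus"

definition ideal_class :: "(nat \<Rightarrow> int) \<Rightarrow> rat poly set set set" where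
  "ideal_class u = ideal_equiv (chi n a) `` {ideal_of u}"

lemma unit_tuples_coprime: "u \<in> unit_tuples \<Longrightarrow> i \<in> {1..n} \<Longrightarrow> coprime (u i) modulus"
  by (auto simp: unit_tuples_def unit_residues_def PiE_def Pi_def)

lemma reduce_in_unit_tuples:
  assumes "\<And>i. i \<in> {1..n} \<Longrightarrow> coprime (u i) modulus"
  shows "(\<lambda>i\<in>{1..n}. u i mod modulus) \<in> unit_tuples"
  unfolding unit_tuples_def
  by (intro restrict_PiE_iff[THEN iffD2] ballI mod_in_unit_residues modulus_pos assms)

lemma card_unit_tuples: "card unit_tuples = totient (nat modulus) ^ n"
  unfolding unit_tuples_def by (simp add: card_PiE card_unit_residues modulus_pos)

lemma ideal_class_eq_iff:
  "ideal_class u = ideal_class w \<longleftrightarrow> (ideal_of u, ideal_of w) \<in> ideal_equiv (chi n a)"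
  unfolding ideal_class_def
  using eq_equiv_class_iff[OF equiv_ideal_equiv] frac_ideal_ideal_of by simp

lemma ideal_class_eqI:
  assumes u: "\<And>i. i \<in> {1..n} \<Longrightarrow> coprime (u i) modulus"
    and w: "\<And>i. i \<in> {1..n} \<Longrightarrow> coprime (w i) modulus"
    and r: "r \<in> node_values n a" and e: "\<And>i. i \<in> {1..n} \<Longrightarrow> e i \<in> {1, -1}"
    and c: "\<And>i. i \<in> {1..n} \<Longrightarrow> coprime (r i) modulus"
      "\<And>i. i \<in> {1..n} \<Longrightarrow> [u i = e i * w i * r i] (mod modulus)"
  shows "ideal_class u = ideal_class w"
proof -
  have "r \<in> node_values n a \<and> (\<forall>i\<in>{1..n}. e i \<in> {1, -1} \<and> coprime (r i) modulus \<and>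
      [u i = e i * w i * r i] (mod modulus))"
    using r e c by blast
  then show ?thesis
    unfolding ideal_class_eq_iff by (subst ideal_of_equiv_iff[OF u w]) blast+
qed

lemma carrier_ideal_class_group: "carrier (ideal_class_group (chi n a)) = ideal_class ` unit_tuples"
proof -
  have "carrier (ideal_class_group (chi n a)) =
      (\<lambda>I. ideal_equiv (chi n a) `` {I}) ` {I. invertible_ideal (chi n a) I}"
    by (auto simp: ideal_class_group_def quotient_def)
  also have "\<dots> = ideal_class ` unit_tuples"
  proof (intro equalityI image_subsetI)
    fix I assume "I \<in> {I. invertible_ideal (chi n a) I}"
    then obtain u where u: "\<And>i. i \<in> {1..n} \<Longrightarrow> coprime (u i) modulus" "(I, ideal_of u) \<in> ideal_equiv (chi n a)"
      using invertible_equiv_ideal_of by blast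
    define u' where "u' = (\<lambda>i\<in>{1..n}. u i mod modulus)"
    have "lattice_of u' = lattice_of u" by (rule lattice_of_cong) (simp add: u'_def cong_def)
    then have "ideal_of u' = ideal_of u" by (simp add: ideal_of_def)
    then have "ideal_equiv (chi n a) `` {I} = ideal_class u'"
      unfolding ideal_class_def using equiv_class_eq[OF equiv_ideal_equiv u(2)] by simp
    moreover have "u' \<in> unit_tuples" unfolding u'_def by (rule reduce_in_unit_tuples[OF u(1)])
    ultimately show "ideal_equiv (chi n a) `` {I} \<in> ideal_class ` unit_tuples" by blast
  next
    fix u assume "u \<in> unit_tuples"
    then have "invertible_ideal (chi n a) (ideal_of u)"
      by (intro invertible_ideal_of unit_tuples_coprime)
    then show "ideal_class u \<in> (\<lambda>I. ideal_equiv (chi n a) `` {I}) ` {I. invertible_ideal (chi n a) I}"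
      unfolding ideal_class_def by blast
  qed
  finally show ?thesis .
qed

lemma class_number_one_if_small:
  assumes "a n - a 1 < 4"
  shows "card (carrier (ideal_class_group (chi n a))) = 1"
proof -
  let ?one = "\<lambda>_::nat. 1::int"
  have "ideal_class u = ideal_class ?one" if u: "u \<in> unit_tuples" for u
  proof -
    note cop = unit_tuples_coprime[OF u]
    have "\<exists>e. (\<forall>i. e i \<in> {1, -1}) \<and> (\<lambda>i. e i * u i) \<in> node_values n a"
      by (rule signs_into_node_values[OF inj_nodes, of modulus])
         (use newton_step_pos[OF mono] newton_step_dvd_modulus newton_step_dvd_6[OF mono assms] cop in auto)
    then obtain e where e: "\<And>i. e i \<in> {1, -1}" "(\<lambda>i. e i * u i) \<in> node_values n a" by blast
    show ?thesis
    proof (rule ideal_class_eqI[OF cop _ e(2) e(1)])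
      fix i assume i: "i \<in> {1..n}"
      show "coprime (e i * u i) modulus" "[u i = e i * 1 * (e i * u i)] (mod modulus)"
        using e(1)[of i] cop[OF i] by auto
    qed auto
  qed
  moreover have "(\<lambda>i\<in>{1..n}. 1 mod modulus) \<in> unit_tuples" using reduce_in_unit_tuples[of ?one] by simp
  ultimately have "ideal_class ` unit_tuples = {ideal_class ?one}" by blast
  then show ?thesis by (simp add: carrier_ideal_class_group)
qed

text \<open>The tuples in the class of \<open>w\<close> are \<open>e w r\<close> modulo \<open>D\<close> with signs \<open>e\<close> and \<open>r\<close> a unit of \<open>R\<close> modulo \<open>D\<close>. The pairs
  \<open>(e, r)\<close> and \<open>(-e, -r)\<close> give the same tuple, so \<open>e\<close> can be normalised to have first entry 1. After that, \<open>e\<close> and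
  \<open>r\<close> are determined: if \<open>(e, r)\<close> and \<open>(e', r')\<close> give the same tuple, then \<open>e e'\<close> is congruent to \<open>r' r\<^sup>-\<^sup>1\<close>, so it
  is a sign tuple in \<open>R\<close> and therefore constant.\<close>
lemma card_ideal_class_fibre:
  assumes n: "n \<ge> 2" and diam: "a n - a 1 \<ge> 4" and w: "w \<in> unit_tuples"
  shows "card {u \<in> unit_tuples. ideal_class u = ideal_class w} =
    2 ^ (n - 1) * card (unit_tuples \<inter> node_values n a)"
proof -
  define E where "E = PiE {1..n} (\<lambda>i. if i = 1 then {1} else {1, -1::int})"
  let ?H = "unit_tuples \<inter> node_values n a"
  \<comment> \<open>The parametrisation of the class of \<open>w\<close> by normalised sign tuples and units of \<open>R\<close> modulo \<open>D\<close>.\<close>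
  define act where "act = (\<lambda>(e, r). \<lambda>i\<in>{1..n}. (e i * w i * r i) mod modulus)"
  have "card E = (\<Prod>i=1..n. if i = 1 then 1 else 2)"
    unfolding E_def by (auto simp: card_PiE numeral_2_eq_2 intro!: prod.cong)
  also have "\<dots> = 2 ^ card ({1..n} - {1})"
    using n by (subst prod.remove[of _ 1]) (auto simp: if_distrib cong: if_cong)
  also have "card ({1..n} - {1}) = n - 1" using n by simp
  finally have cardE: "card E = 2 ^ (n - 1)" .
  have sgn: "e i \<in> {1, -1}" if "e \<in> E" "i \<in> {1..n}" for e i
    using that unfolding E_def by (auto dest!: PiE_mem[of _ _ _ i] split: if_splits)
  have sgn1: "e 1 = 1" if "e \<in> E" for e
    using that n unfolding E_def by (auto dest!: PiE_mem[of _ _ _ 1])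
  note wcop = unit_tuples_coprime[OF w]
  have "bij_betw act (E \<times> ?H) {u \<in> unit_tuples. ideal_class u = ideal_class w}"
  proof (rule bij_betw_imageI)
    show "inj_on act (E \<times> ?H)"
    proof (rule inj_onI, clarify)
      fix e r e' r' assume E: "e \<in> E" "e' \<in> E" and H: "r \<in> unit_tuples" "r \<in> node_values n a"
        "r' \<in> unit_tuples" "r' \<in> node_values n a" and eq: "act (e, r) = act (e', r')"
      have c: "[e i * r i = e' i * r' i] (mod modulus)" if i: "i \<in> {1..n}" for i
      proof -
        have "[w i * (e i * r i) = w i * (e' i * r' i)] (mod modulus)"
          using fun_cong[OF eq, of i] i by (simp add: act_def cong_def mult_ac)
        then show ?thesis using cong_mult_lcancel[OF wcop[OF i]] by blast
      qed
      obtain s where s: "s \<in> node_values n a" "\<And>i. i \<in> {1..n} \<Longrightarrow> [r i * s i = 1] (mod modulus)"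
        by (rule node_values_inverse[OF H(2)]) (use unit_tuples_coprime[OF H(1)] in auto)
      have "(\<lambda>i. e i * e' i) \<in> node_values n a"
      proof (rule node_values_cong_modulus[OF node_values_mult[OF H(4) s(1)]])
        fix i assume i: "i \<in> {1..n}"
        have e2: "e' i * e' i = 1" using sgn[OF E(2) i] by auto
        have "[e i * e' i * (r i * s i) = e i * e' i * 1] (mod modulus)" by (rule cong_scalar_left[OF s(2)[OF i]])
        then have "[e i * e' i = (e i * r i) * (e' i * s i)] (mod modulus)"
          by (simp add: mult_ac cong_sym)
        also have "[(e i * r i) * (e' i * s i) = (e' i * r' i) * (e' i * s i)] (mod modulus)"
          by (rule cong_scalar_right[OF c[OF i]])
        also have "(e' i * r' i) * (e' i * s i) = (e' i * e' i) * (r' i * s i)" by (simp add: mult_ac)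
        finally show "[e i * e' i = r' i * s i] (mod modulus)" using e2 by simp
      qed
      moreover have "e i * e' i \<in> {1, -1}" if "i \<in> {1..n}" for i
        using sgn[OF E(1) that] sgn[OF E(2) that] by auto
      ultimately have const: "e i * e' i = e 1 * e' 1" if "i \<in> {1..n}" for i
        using unit_node_values_constant[OF mono n diam _ _ that, of "\<lambda>i. e i * e' i"] by blast
      have ee: "e i = e' i" if "i \<in> {1..n}" for i
        using const[OF that] sgn1[OF E(1)] sgn1[OF E(2)] sgn[OF E(1) that] sgn[OF E(2) that] by auto
      have "e = e'" using E ee unfolding E_def by (intro PiE_ext)
      moreover have "r i = r' i" if i: "i \<in> {1..n}" for i
      proof -
        have "[e i * (e i * r i) = e i * (e' i * r' i)] (mod modulus)" by (rule cong_scalar_left[OF c[OF i]])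
        then have "[(e i * e i) * r i = (e i * e i) * r' i] (mod modulus)" unfolding ee[OF i, symmetric] by (simp add: mult.assoc)
        moreover have "e i * e i = 1" using sgn[OF E(1) i] by auto
        ultimately have "[r i = r' i] (mod modulus)" by simp
        moreover have "r i \<in> {0..<modulus}" "r' i \<in> {0..<modulus}"
          using H(1,3) i by (auto simp: unit_tuples_def unit_residues_def PiE_def Pi_def)
        ultimately show ?thesis by (simp add: cong_def)
      qed
      then have "r = r'" using H unfolding unit_tuples_def by (intro PiE_ext)
      ultimately show "e = e' \<and> r = r'" by simp
    qed
    show "act ` (E \<times> ?H) = {u \<in> unit_tuples. ideal_class u = ideal_class w}"
    proof (intro equalityI subsetI)
      fix u assume "u \<in> act ` (E \<times> ?H)"
      then obtain e r where er: "e \<in> E" "r \<in> unit_tuples" "r \<in> node_values n a" "u = act (e, r)" by blast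
      have e2: "coprime (e i * w i * r i) modulus" if "i \<in> {1..n}" for i
        using sgn[OF er(1) that] wcop[OF that] unit_tuples_coprime[OF er(2) that] by auto
      then have u: "u \<in> unit_tuples" unfolding er(4) act_def prod.case by (rule reduce_in_unit_tuples)
      have "ideal_class u = ideal_class w"
      proof (rule ideal_class_eqI[OF unit_tuples_coprime[OF u] wcop er(3) sgn[OF er(1)] unit_tuples_coprime[OF er(2)]])
        show "[u i = e i * w i * r i] (mod modulus)" if "i \<in> {1..n}" for i
          using that unfolding er(4) by (simp add: act_def cong_def)
      qed
      then show "u \<in> {u \<in> unit_tuples. ideal_class u = ideal_class w}" using u by simp
    next
      fix u assume "u \<in> {u \<in> unit_tuples. ideal_class u = ideal_class w}"
      then have u: "u \<in> unit_tuples" "ideal_class u = ideal_class w" by auto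
      have "(ideal_of u, ideal_of w) \<in> ideal_equiv (chi n a)" using u(2) by (simp only: ideal_class_eq_iff)
      then have "\<exists>e r. r \<in> node_values n a \<and> (\<forall>i\<in>{1..n}. e i \<in> {1, -1} \<and> coprime (r i) modulus \<and>
          [u i = e i * w i * r i] (mod modulus))"
        by (subst (asm) ideal_of_equiv_iff[of u w]) (use unit_tuples_coprime[OF u(1)] wcop in blast)+
      then obtain e r where r: "r \<in> node_values n a" and er: "\<And>i. i \<in> {1..n} \<Longrightarrow> e i \<in> {1, -1}"
        "\<And>i. i \<in> {1..n} \<Longrightarrow> coprime (r i) modulus" "\<And>i. i \<in> {1..n} \<Longrightarrow> [u i = e i * w i * r i] (mod modulus)"
        by blast
      have e1: "e 1 \<in> {1, -1}" using er(1)[of 1] n by simp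
      \<comment> \<open>Multiplying both \<open>e\<close> and \<open>r\<close> by the sign \<open>e 1\<close> normalises the pair.\<close>
      define e' where "e' = (\<lambda>i\<in>{1..n}. e 1 * e i)"
      define r' where "r' = (\<lambda>i\<in>{1..n}. (e 1 * r i) mod modulus)"
      have "e 1 * e i \<in> (if i = 1 then {1} else {1, -1})" if "i \<in> {1..n}" for i
        using e1 er(1)[OF that] by auto
      then have "e' \<in> E"
        unfolding e'_def E_def by (intro restrict_PiE_iff[THEN iffD2] ballI)
      moreover have "r' \<in> unit_tuples"
        unfolding r'_def by (rule reduce_in_unit_tuples) (use e1 er(2) in auto)
      moreover have "r' \<in> node_values n a"
        by (rule node_values_cong_modulus[OF node_values_mult[OF node_values_const[of "e 1"] r]])
           (simp add: r'_def cong_def)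
      moreover have "u = act (e', r')"
      proof (rule extensionalityI)
        show "u \<in> extensional {1..n}" using u(1) by (simp add: unit_tuples_def PiE_def)
        show "act (e', r') \<in> extensional {1..n}" by (simp add: act_def)
        fix i assume i: "i \<in> {1..n}"
        have "e 1 * e 1 = 1" using e1 by auto
        have "act (e', r') i = (e 1 * e i * w i * (e 1 * r i)) mod modulus"
          using i by (simp add: act_def e'_def r'_def mod_simps)
        also have "e 1 * e i * w i * (e 1 * r i) = (e 1 * e 1) * (e i * w i * r i)" by (simp add: mult_ac)
        also have "\<dots> mod modulus = u i mod modulus"
          using er(3)[OF i] \<open>e 1 * e 1 = 1\<close> by (simp add: cong_def)
        also have "\<dots> = u i" using u(1) i by (auto simp: unit_tuples_def unit_residues_def PiE_def Pi_def)
        finally show "u i = act (e', r') i" by simp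
      qed
      ultimately show "u \<in> act ` (E \<times> ?H)" by blast
    qed
  qed
  from bij_betw_same_card[OF this] show ?thesis by (simp add: card_cartesian_product cardE)
qed

lemma class_number_if_large:
  assumes n: "n \<ge> 2" and diam: "a n - a 1 \<ge> 4"
  shows "card (carrier (ideal_class_group (chi n a))) * 2 ^ (n - 1) =
    (\<Prod>j=1..n. totient (nat (newton_step a j)))"
proof -
  let ?h = "card (unit_tuples \<inter> node_values n a)" and ?c = "card (ideal_class ` unit_tuples)"
  let ?p = "\<Prod>j=1..n. totient (nat (newton_step a j))"
  have fin: "finite unit_tuples" unfolding unit_tuples_def by (intro finite_PiE) auto
  have "card unit_tuples = 2 ^ (n - 1) * ?h * ?c"
    by (rule card_eq_mult_fibres[OF fin]) (use card_ideal_class_fibre[OF n diam] in auto)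
  moreover have hp: "?h * ?p = totient (nat modulus) ^ n"
    unfolding unit_tuples_def
    by (rule card_unit_node_values[OF inj_nodes modulus_pos])
       (use newton_step_pos[OF mono] newton_step_dvd_modulus in auto)
  ultimately have "?h * ?p = 2 ^ (n - 1) * ?h * ?c" by (simp only: card_unit_tuples)
  then have "?h * (?c * 2 ^ (n - 1)) = ?h * ?p" by (simp only: mult_ac)
  moreover have "?h \<noteq> 0"
    using hp modulus_pos by (intro notI) simp
  ultimately show ?thesis unfolding carrier_ideal_class_group using mult_left_cancel by blast
qed

end

theorem theorem1p1:
  fixes n :: nat and a :: "nat \<Rightarrow> int"
  assumes "n \<ge> 2" and "strict_mono_on {1..n} a"
  shows "(a n - a 1 \<ge> 4 \<longrightarrow>
            real (card (carrier (ideal_class_group (chi n a)))) =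
              real (totient (Delta n a (n - 1))) / 2 ^ (n - 1) *
              (\<Prod>l=1..n - 2. real (totient (Delta n a l)) / real (Delta n a l))) \<and>
         (a n - a 1 < 4 \<longrightarrow> card (carrier (ideal_class_group (chi n a))) = 1)"
proof -
  interpret integer_nodes n a by unfold_locales (rule assms(2))
  have "real (card (carrier (ideal_class_group (chi n a)))) =
      real (totient (Delta n a (n - 1))) / 2 ^ (n - 1) *
      (\<Prod>l=1..n - 2. real (totient (Delta n a l)) / real (Delta n a l))" if "a n - a 1 \<ge> 4"
  proof -
    have "real (card (carrier (ideal_class_group (chi n a)))) * 2 ^ (n - 1) =
        real (\<Prod>j=1..n. totient (nat (newton_step a j)))"
      unfolding class_number_if_large[OF assms(1) that, symmetric] by simp
    also have "\<dots> = real (totient (Delta n a (n - 1))) *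
        (\<Prod>l=1..n - 2. real (totient (Delta n a l)) / real (Delta n a l))"
      by (rule prod_totient_newton_step[OF assms(2,1)])
    finally show ?thesis by (simp add: field_simps)
  qed
  then show ?thesis using class_number_one_if_small by blast
qed

end
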